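(* For every $n\ge1$ and $\lambda\vdash n$, $$s_\lambda\!\left[\frac{1}{(1-q_1)(1-q_2)\cdots}\right]=\frac{\sum_{T\in\mathrm{SYT}(\lambda)}\sum_{\vec{\sigma}\in {}_{\mathrm{des}(T)}S_n^{\infty}} Q^{\mathrm{Comaj}_{\mathrm{des}(T)}(\vec{\sigma})}}{\prod_{i\ge1}(q_i;q_i)_n}.$$
   Context: The left side is $s_\lambda$ evaluated at all monomials in the countably many variables $q_1,q_2,\dots$ (equivalently $s_\lambda$ plethystically evaluated at $\sum_{i\ge0}h_i[q_1+q_2+\cdots]$). $(q;t)_r=(1-q)(1-qt)\cdots(1-qt^{r-1})$. $\mathrm{SYT}(\lambda)$: standard Young tableaux of shape $\lambda$; $\epsilon$: identity of $S_n$. For a standard tableau $T$ with $n$ cells, $\mathrm{des}(T)$ is the set of $i$ such that $i+1$ lies in a strictly lower row than $i$ (English notation). Definitions. $\mathbb{N}=\{0,1,\dots\}$; sequences in $\mathbb{N}^r$ are compared lexicographically. For $R\subseteq\{1,\dots,n-1\}$ and distinct $a,b$, write $a\sim_R b$ if all of $\min(a,b),\dots,\max(a,b)-1$ lie in $R$. For $S=(s^1,\dots,s^n)\in(\mathbb{N}^r)^n$ (if $r=0$ all $s^i$ are empty and equal) and $\sigma\in S_n$, $\mathrm{Des}_{R,S}(\sigma)$ is the set of $i\in\{1,\dots,n-1\}$ with either $s^{\sigma_i}>s^{\sigma_{i+1}}$, or $s^{\sigma_i}=s^{\sigma_{i+1}}$ and either ($\sigma_{i+1}<\sigma_i$ and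 not $\sigma_{i+1}\sim_R\sigma_i$) or ($\sigma_{i+1}>\sigma_i$ and $\sigma_i\sim_R\sigma_{i+1}$). $\mathrm{Comaj}_{R,S}(\sigma)=\sum_{i\in\mathrm{Des}_{R,S}(\sigma)}(n-i)$. $Z_{R,\sigma}(S)\in(\mathbb{N}^{r+1})^n$ prepends to each $s^j$ a first coordinate $z^j_1$ with $z^{\sigma_i}_1=\#\{j<i:j\in\mathrm{Des}_{R,S}(\sigma)\}$. For $\vec{\pi}=(\pi^1,\dots,\pi^{k-1})\in S_n^{\times(k-1)}$ ($k\ge1$), set $\pi^k=\epsilon$, $Z^0=$ list of $n$ empty sequences, $Z^i=Z_{R,\pi^i}(Z^{i-1})$, $\mathrm{comaj}^i_R(\vec{\pi})=\mathrm{Comaj}_{R,Z^{i-1}}(\pi^i)$, $1\le i\le k$. Let $\tau_R\in S_n$ be the unique permutation with $\mathrm{Comaj}_{R,\emptyset}(\tau_R)=0$, where $\emptyset$ denotes the list of $n$ empty sequences. ${}_RS_n^\infty$ is the set of infinite sequences $\vec{\sigma}=(\sigma^1,\sigma^2,\dots)$ in $S_n$ with $\sigma^1=\epsilon$ and $\sigma^i=\tau_R$ for all sufficiently large $i$. For such $\vec\sigma$ let $m\ge1$ be smallest such that $\sigma^i=\tau_R$ for all $i>m$, and set $Q^{\mathrm{Comaj}_R(\vec{\sigma})}=\prod_{j=1}^m q_j^{\mathrm{comaj}^{m-j+1}_R(\sigma^m,\sigma^{m-1},\dots,\sigma^2)}$ (here $(\sigma^m,\dots,\sigma^2)$ is an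 $(m-1)$-tuple, empty if $m=1$). *)

theory Defs
  imports "HOL-Library.Poly_Mapping" "HOL-Library.List_Lexorder"
    "HOL-Combinatorics.Permutations" "HOL-Computational_Algebra.Polynomial"
begin

text \<open>Variable q_(i+1) is encoded by the index i :: nat; a monomial is a finitely
 supported exponent vector (a finitely supported map nat to nat); a formal power series is its coefficient
 function.\<close>

type_synonym mon = "nat \<Rightarrow>\<^sub>0 nat"
type_synonym mser = "mon \<Rightarrow> int"

definition ser_one :: mser where
  "ser_one a = (if a = 0 then 1 else 0)"

definition ser_mult :: "mser \<Rightarrow> mser \<Rightarrow> mser" where
  "ser_mult f g a = (\<Sum>(b, c) \<in> {(b, c). b + c = a}. f b * g c)"

definition ser_inv :: "mser \<Rightarrow> mser" where
  "ser_inv f = (THE g. ser_mult f g = ser_one)"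

definition qpoch :: "nat \<Rightarrow> int poly" where
  "qpoch n = (\<Prod>j\<in>{1..n}. 1 - monom 1 j)"

text \<open>The series \<Prod>_{i\<ge>1} (q_i;q_i)_n: the coefficient of q^c is the product over all
 variables of the coefficient of q_i^(c_i) in (q_i;q_i)_n (factors with c_i = 0 equal 1).\<close>
definition qpoch_prod :: "nat \<Rightarrow> mser" where
  "qpoch_prod n c = (\<Prod>i\<in>Poly_Mapping.keys c. coeff (qpoch n) (Poly_Mapping.lookup c i))"

definition is_partition :: "nat \<Rightarrow> nat list \<Rightarrow> bool" where
  "is_partition n lam \<longleftrightarrow> sorted (rev lam) \<and> (\<forall>x\<in>set lam. 0 < x) \<and> sum_list lam = n"

text \<open>Cells (row, column), 0-indexed, English notation.\<close>
definition cells :: "nat list \<Rightarrow> (nat \<times> nat) set" where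
  "cells lam = {(i, j). i < length lam \<and> j < lam ! i}"

definition ssyt :: "nat list \<Rightarrow> (nat \<times> nat \<Rightarrow> 'a::{linorder,zero}) \<Rightarrow> bool" where
  "ssyt lam T \<longleftrightarrow>
     (\<forall>c. c \<notin> cells lam \<longrightarrow> T c = 0) \<and>
     (\<forall>i j. (i, j + 1) \<in> cells lam \<longrightarrow> T (i, j) \<le> T (i, j + 1)) \<and>
     (\<forall>i j. (i + 1, j) \<in> cells lam \<longrightarrow> T (i, j) < T (i + 1, j))"

text \<open>s_lam evaluated at all monomials q^m (each monomial being one variable x_m of the
 Schur function, monomials linearly ordered by the library order on poly_mapping):
 s_lam(x) = \<Sum>_{T SSYT} \<Prod>_c x_{T c}, so the coefficient of q^a is the number of SSYT with
 monomial entries whose product is q^a.\<close>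
definition schur_all_monomials :: "nat list \<Rightarrow> mser" where
  "schur_all_monomials lam a =
     int (card {T :: nat \<times> nat \<Rightarrow> mon. ssyt lam T \<and> (\<Sum>c\<in>cells lam. T c) = a})"

definition syt :: "nat list \<Rightarrow> (nat \<times> nat \<Rightarrow> nat) \<Rightarrow> bool" where
  "syt lam T \<longleftrightarrow>
     bij_betw T (cells lam) {1..sum_list lam} \<and>
     (\<forall>c. c \<notin> cells lam \<longrightarrow> T c = 0) \<and>
     (\<forall>i j. (i, j + 1) \<in> cells lam \<longrightarrow> T (i, j) < T (i, j + 1)) \<and>
     (\<forall>i j. (i + 1, j) \<in> cells lam \<longrightarrow> T (i, j) < T (i + 1, j))"

definition row_of :: "nat list \<Rightarrow> (nat \<times> nat \<Rightarrow> nat) \<Rightarrow> nat \<Rightarrow> nat" where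
  "row_of lam T k = fst (THE c. c \<in> cells lam \<and> T c = k)"

definition des :: "nat list \<Rightarrow> (nat \<times> nat \<Rightarrow> nat) \<Rightarrow> nat set" where
  "des lam T = {i. 1 \<le> i \<and> i < sum_list lam \<and> row_of lam T i < row_of lam T (i + 1)}"

text \<open>Permutations of {1..n} are functions nat \<Rightarrow> nat permuting {1..n};
 a list S of n sequences is a function from {1..n} to nat list (lexicographic order).\<close>

definition sim :: "nat set \<Rightarrow> nat \<Rightarrow> nat \<Rightarrow> bool" where
  "sim R a b \<longleftrightarrow> a \<noteq> b \<and> {min a b..<max a b} \<subseteq> R"

definition Des :: "nat set \<Rightarrow> nat \<Rightarrow> (nat \<Rightarrow> nat list) \<Rightarrow> (nat \<Rightarrow> nat) \<Rightarrow> nat set" where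
  "Des R n S \<sigma> = {i. 1 \<le> i \<and> i < n \<and>
     (S (\<sigma> i) > S (\<sigma> (i + 1)) \<or>
      (S (\<sigma> i) = S (\<sigma> (i + 1)) \<and>
        ((\<sigma> (i + 1) < \<sigma> i \<and> \<not> sim R (\<sigma> (i + 1)) (\<sigma> i)) \<or>
         (\<sigma> (i + 1) > \<sigma> i \<and> sim R (\<sigma> i) (\<sigma> (i + 1))))))}"

definition Comaj :: "nat set \<Rightarrow> nat \<Rightarrow> (nat \<Rightarrow> nat list) \<Rightarrow> (nat \<Rightarrow> nat) \<Rightarrow> nat" where
  "Comaj R n S \<sigma> = (\<Sum>i\<in>Des R n S \<sigma>. n - i)"

definition Zstep :: "nat set \<Rightarrow> nat \<Rightarrow> (nat \<Rightarrow> nat) \<Rightarrow> (nat \<Rightarrow> nat list) \<Rightarrow> (nat \<Rightarrow> nat list)" where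
  "Zstep R n \<sigma> S = (\<lambda>j. card {k \<in> Des R n S \<sigma>. k < inv \<sigma> j} # S j)"

text \<open>Z^i for the list ps = [\<pi>^1, ..., \<pi>^k] (0-indexed list).\<close>
fun Zseq :: "nat set \<Rightarrow> nat \<Rightarrow> (nat \<Rightarrow> nat) list \<Rightarrow> nat \<Rightarrow> (nat \<Rightarrow> nat list)" where
  "Zseq R n ps 0 = (\<lambda>j. [])"
| "Zseq R n ps (Suc i) = Zstep R n (ps ! i) (Zseq R n ps i)"

text \<open>comaj^i_R(\<pi>^1,...,\<pi>^{k-1}) with \<pi>^k = \<epsilon>, for 1 \<le> i \<le> k.\<close>
definition comaj_i :: "nat set \<Rightarrow> nat \<Rightarrow> (nat \<Rightarrow> nat) list \<Rightarrow> nat \<Rightarrow> nat" where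
  "comaj_i R n pis i =
     (let ps = pis @ [id] in Comaj R n (Zseq R n ps (i - 1)) (ps ! (i - 1)))"

definition tau :: "nat set \<Rightarrow> nat \<Rightarrow> (nat \<Rightarrow> nat)" where
  "tau R n = (THE \<tau>. \<tau> permutes {1..n} \<and> Comaj R n (\<lambda>j. []) \<tau> = 0)"

text \<open>_R S_n^\<infinity>: sequences (\<sigma>^1, \<sigma>^2, ...) indexed from 1 (index 0 fixed to id as a
 normalisation, it carries no information).\<close>
definition seqs :: "nat set \<Rightarrow> nat \<Rightarrow> (nat \<Rightarrow> nat \<Rightarrow> nat) set" where
  "seqs R n = {sig. sig 0 = id \<and> sig 1 = id \<and> (\<forall>i\<ge>1. sig i permutes {1..n}) \<and>
                    (\<exists>N. \<forall>i>N. sig i = tau R n)}"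

definition mval :: "nat set \<Rightarrow> nat \<Rightarrow> (nat \<Rightarrow> nat \<Rightarrow> nat) \<Rightarrow> nat" where
  "mval R n sig = (LEAST m. 1 \<le> m \<and> (\<forall>i>m. sig i = tau R n))"

text \<open>Exponent vector of Q^{Comaj_R(\<sigma>)}: the exponent of q_j (index j-1) is
 comaj^{m-j+1}_R(\<sigma>^m, ..., \<sigma>^2) for 1 \<le> j \<le> m, and 0 otherwise.\<close>
definition Qexp :: "nat set \<Rightarrow> nat \<Rightarrow> (nat \<Rightarrow> nat \<Rightarrow> nat) \<Rightarrow> mon" where
  "Qexp R n sig =
     (let m = mval R n sig in
      Abs_poly_mapping (\<lambda>i. if i < m then comaj_i R n (map sig (rev [2..<m+1])) (m - i) else 0))"

definition numer :: "nat list \<Rightarrow> mser" where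
  "numer lam a = (\<Sum>T\<in>{T. syt lam T}.
      int (card {sig \<in> seqs (des lam T) (sum_list lam). Qexp (des lam T) (sum_list lam) sig = a}))"

end

theory Submission
  imports Defs "HOL-Computational_Algebra.Polynomial_FPS"
begin

text \<open>Standardization writes a semistandard tableau with monomial entries uniquely as a standard
  tableau \<open>T\<close> composed with a word \<open>w\<^sub>1 \<le> \<dots> \<le> w\<^sub>n\<close> of monomials that increases strictly at \<open>des T\<close>.
  For each \<open>i\<close>, let \<open>\<sigma>\<^sup>i\<close> sort the letters by their exponents of \<open>q\<^sub>i, q\<^sub>i\<^sub>+\<^sub>1, \<dots>\<close> lexicographically, ties
  being broken as in \<open>\<tau>\<^sub>R\<close>. Then \<open>\<sigma>\<^sup>1\<close> is the identity, \<open>\<sigma>\<^sup>i = \<tau>\<^sub>R\<close> for large \<open>i\<close>, and the \<open>q\<^sub>i\<close>-exponents read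
  in the order \<open>\<sigma>\<^sup>i\<close> form a weakly increasing sequence that is strict wherever \<open>\<sigma>\<^sup>i\<close> disagrees with
  \<open>\<sigma>\<^sup>i\<^sup>+\<^sup>1\<close>. Subtracting the smallest such sequence, whose sum is the corresponding \<open>comaj\<close>, leaves an
  arbitrary partition with at most \<open>n\<close> parts, which accounts for the factor \<open>1 / (q\<^sub>i; q\<^sub>i)\<^sub>n\<close>.\<close>

section \<open>Ranks in finite total orders\<close>

text \<open>One plus the number of smaller elements is injective and stays within
  \<open>{1..card A}\<close>, so counting makes it onto. Both the sorting permutations and the
  standard tableaux below arise as such ranks.\<close>

lemma ex_rank:
  assumes fin: "finite A"
    and irr: "\<And>a. a \<in> A \<Longrightarrow> \<not> lt a a"
    and trans: "\<And>a b c. \<lbrakk>a \<in> A; b \<in> A; c \<in> A; lt a b; lt b c\<rbrakk> \<Longrightarrow> lt a c"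
    and total: "\<And>a b. \<lbrakk>a \<in> A; b \<in> A; a \<noteq> b\<rbrakk> \<Longrightarrow> lt a b \<or> lt b a"
  shows "\<exists>r. bij_betw r A {1..card A} \<and> (\<forall>a\<in>A. \<forall>b\<in>A. r a < r b \<longleftrightarrow> lt a b)"
proof -
  define r where "r a = Suc (card {b\<in>A. lt b a})" for a
  have mono: "r a < r b" if "a \<in> A" "b \<in> A" "lt a b" for a b
  proof -
    have "{c\<in>A. lt c a} \<subset> {c\<in>A. lt c b}"
      using that irr trans by blast
    then show ?thesis
      unfolding r_def using fin by (simp add: psubset_card_mono)
  qed
  have iff: "r a < r b \<longleftrightarrow> lt a b" if "a \<in> A" "b \<in> A" for a b
    using mono that total by (metis less_asym less_irrefl)
  have inj: "inj_on r A"
    using mono total by (metis inj_onI less_irrefl)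
  have "r a \<in> {1..card A}" if "a \<in> A" for a
  proof -
    have "{b\<in>A. lt b a} \<subset> A"
      using that irr by blast
    then have "card {b\<in>A. lt b a} < card A"
      using fin by (simp add: psubset_card_mono)
    then show ?thesis by (simp add: r_def)
  qed
  then have "r ` A \<subseteq> {1..card A}" by blast
  then have "r ` A = {1..card A}"
    using inj by (simp add: card_image card_subset_eq)
  then have "bij_betw r A {1..card A}"
    using inj by (simp add: bij_betw_def)
  with iff show ?thesis by blast
qed

text \<open>\<open>r a - 1\<close> counts the elements below \<open>a\<close>, so the order alone
  determines the rank.\<close>

lemma rank_unique:
  fixes r s :: "'a \<Rightarrow> nat"
  assumes r: "bij_betw r A {1..N}" and s: "bij_betw s A {1..N}"
    and rs: "\<And>a b. \<lbrakk>a \<in> A; b \<in> A\<rbrakk> \<Longrightarrow> r a < r b \<longleftrightarrow> s a < s b"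
    and a: "a \<in> A"
  shows "r a = s a"
proof -
  have *: "card {b\<in>A. f b < f a} = f a - 1" if f: "bij_betw f A {1..N}" for f :: "'a \<Rightarrow> nat"
  proof -
    have "f ` {b\<in>A. f b < f a} = {1..<f a}"
    proof
      show "f ` {b\<in>A. f b < f a} \<subseteq> {1..<f a}"
        using bij_betw_apply[OF f] by auto
      show "{1..<f a} \<subseteq> f ` {b\<in>A. f b < f a}"
      proof
        fix k assume k: "k \<in> {1..<f a}"
        then have "k \<in> f ` A"
          using bij_betw_apply[OF f a] bij_betw_imp_surj_on[OF f] by auto
        then show "k \<in> f ` {b\<in>A. f b < f a}" using k by auto
      qed
    qed
    moreover have "inj_on f {b\<in>A. f b < f a}"
      using f by (auto simp: bij_betw_def intro: inj_on_subset)
    ultimately show ?thesis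
      by (metis card_atLeastLessThan card_image)
  qed
  have "{b\<in>A. r b < r a} = {b\<in>A. s b < s a}"
    using rs a by blast
  then have "r a - 1 = s a - 1" using *[OF r] *[OF s] by simp
  moreover have "r a \<ge> 1" "s a \<ge> 1" using r s a by (auto simp: bij_betw_def)
  ultimately show ?thesis by simp
qed

section \<open>Descents and sorting\<close>

text \<open>\<open>Des\<close> compares positions by the strict total order \<open>slt R S\<close>: first by the sequences
  \<open>S\<close>, ties being broken by the natural order with every block of \<open>\<sim>\<^sub>R\<close>-related numbers reversed.\<close>

definition rlt :: "nat set \<Rightarrow> nat \<Rightarrow> nat \<Rightarrow> bool" where
  "rlt R a b \<longleftrightarrow> (if sim R a b then b < a else a < b)"

definition slt :: "nat set \<Rightarrow> (nat \<Rightarrow> nat list) \<Rightarrow> nat \<Rightarrow> nat \<Rightarrow> bool" where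
  "slt R S a b \<longleftrightarrow> S a < S b \<or> S a = S b \<and> rlt R a b"

definition sorts :: "nat set \<Rightarrow> nat \<Rightarrow> (nat \<Rightarrow> nat list) \<Rightarrow> (nat \<Rightarrow> nat) \<Rightarrow> bool" where
  "sorts R n S \<sigma> \<longleftrightarrow>
     \<sigma> permutes {1..n} \<and> (\<forall>j. 1 \<le> j \<and> j < n \<longrightarrow> slt R S (\<sigma> j) (\<sigma> (j + 1)))"

text \<open>The ordinary descent set of \<open>inv \<pi> \<circ> \<sigma>\<close>: the places where
  the listing \<open>\<sigma>\<close> goes against the order in which \<open>\<pi>\<close>
  lists.\<close>

definition inv_descents :: "nat \<Rightarrow> (nat \<Rightarrow> nat) \<Rightarrow> (nat \<Rightarrow> nat) \<Rightarrow> nat set" where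
  "inv_descents n \<pi> \<sigma> = {j. 1 \<le> j \<and> j < n \<and> inv \<pi> (\<sigma> (j + 1)) < inv \<pi> (\<sigma> j)}"

definition inv_comaj :: "nat \<Rightarrow> (nat \<Rightarrow> nat) \<Rightarrow> (nat \<Rightarrow> nat) \<Rightarrow> nat" where
  "inv_comaj n \<pi> \<sigma> = (\<Sum>j\<in>inv_descents n \<pi> \<sigma>. n - j)"

lemma sim_sym: "sim R a b \<longleftrightarrow> sim R b a"
  by (auto simp: sim_def min.commute max.commute)

lemma rlt_irrefl: "\<not> rlt R a a"
  by (simp add: rlt_def)

lemma rlt_total: "a \<noteq> b \<Longrightarrow> rlt R a b \<or> rlt R b a"
  using sim_sym[of R a b] by (auto simp: rlt_def)

lemma rlt_asym: "rlt R a b \<Longrightarrow> \<not> rlt R b a"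
  using sim_sym[of R a b] by (auto simp: rlt_def split: if_splits)

lemma sim_trans:
  assumes "sim R a b" "sim R b c" "a \<noteq> c"
  shows "sim R a c"
proof -
  have "{min a c..<max a c} \<subseteq> {min a b..<max a b} \<union> {min b c..<max b c}"
    by auto
  then show ?thesis using assms unfolding sim_def by blast
qed

lemma sim_between:
  assumes "sim R a c" "a < b" "b < c"
  shows "sim R a b" "sim R b c"
  using assms by (auto simp: sim_def)

text \<open>The blocks of \<open>sim R\<close> are intervals, so reversing each of them in place
  gives another linear order. In the mixed cases the number outside the block lies on the same side
  of the two numbers inside it.\<close>

lemma rlt_trans:
  assumes "rlt R a b" "rlt R b c"
  shows "rlt R a c"
proof -
  have ne: "a \<noteq> c" using assms rlt_asym by blast
  show ?thesis
  proof (rule ccontr)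
    assume "\<not> rlt R a c"
    then have ca: "rlt R c a" using rlt_total ne by blast
    consider "sim R a b" "sim R b c" | "sim R a b" "\<not> sim R b c" | "\<not> sim R a b" "sim R b c"
      | "\<not> sim R a b" "\<not> sim R b c" by blast
    then show False
    proof cases
      case 1
      then show ?thesis using assms ca sim_trans[OF 1 ne] sim_sym[of R a c]
        by (auto simp: rlt_def)
    next
      case 2
      then have nac: "\<not> sim R c a" using sim_trans[of R b a c] sim_sym assms rlt_irrefl by metis
      then show ?thesis using 2 assms ca sim_between[of R b a c] sim_sym
        by (metis linorder_neqE_nat order.strict_trans rlt_def)
    next
      case 3
      then have nac: "\<not> sim R c a" using sim_trans[of R a c b] sim_sym assms rlt_irrefl by metis
      then show ?thesis using 3 assms ca sim_sym sim_between[of R c b a]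
        by (metis linorder_neqE_nat order.strict_trans rlt_def sim_between)
    next
      case 4
      then have "a < b" "b < c" using assms by (auto simp: rlt_def)
      then show ?thesis using 4 ca sim_between[of R a c b] sim_sym[of R a c] by (auto simp: rlt_def split: if_splits)
    qed
  qed
qed

lemma slt_irrefl: "\<not> slt R S a a"
  by (simp add: slt_def rlt_irrefl)

lemma slt_total: "a \<noteq> b \<Longrightarrow> slt R S a b \<or> slt R S b a"
  using rlt_total[of a b R] by (auto simp: slt_def)

lemma slt_trans: "slt R S a b \<Longrightarrow> slt R S b c \<Longrightarrow> slt R S a c"
  using rlt_trans[of R a b c] by (auto simp: slt_def)

lemma slt_asym: "slt R S a b \<Longrightarrow> \<not> slt R S b a"
  using slt_irrefl slt_trans by blast

lemma slt_Cons:
  "slt R (\<lambda>a. z a # S a) a b \<longleftrightarrow> z a < z b \<or> z a = z b \<and> slt R S a b"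
  by (auto simp: slt_def)

lemma sorts_mono:
  assumes "sorts R n S \<sigma>" "1 \<le> i" "i < j" "j \<le> n"
  shows "slt R S (\<sigma> i) (\<sigma> j)"
  using \<open>i < j\<close> \<open>j \<le> n\<close>
proof (induction j rule: less_induct)
  case (less j)
  then obtain k where k: "j = k + 1" by (metis add.commute less_imp_Suc_add plus_1_eq_Suc)
  have step: "slt R S (\<sigma> k) (\<sigma> (k + 1))"
    using assms(1,2) less.prems k by (auto simp: sorts_def)
  show ?case
  proof (cases "i = k")
    case True
    then show ?thesis using step k by simp
  next
    case False
    then have "slt R S (\<sigma> i) (\<sigma> k)" using less k by simp
    then show ?thesis using step k slt_trans by blast
  qed
qed

lemma permutes_inv_in:
  assumes "\<sigma> permutes {1..n}" "a \<in> {1..n}"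
  shows "inv \<sigma> a \<in> {1..n}" "\<sigma> a \<in> {1..n}"
  using assms permutes_in_image permutes_inv by metis+

lemma sorts_slt_iff:
  assumes "sorts R n S \<sigma>" "a \<in> {1..n}" "b \<in> {1..n}"
  shows "slt R S a b \<longleftrightarrow> inv \<sigma> a < inv \<sigma> b"
proof -
  have p: "\<sigma> permutes {1..n}" using assms by (simp add: sorts_def)
  have *: "slt R S a b" if "inv \<sigma> a < inv \<sigma> b" "a \<in> {1..n}" "b \<in> {1..n}" for a b
    using sorts_mono[OF assms(1) _ that(1)] permutes_inv_in[OF p that(2)]
      permutes_inv_in[OF p that(3)] permutes_inverses[OF p] by auto
  have "inv \<sigma> a \<noteq> inv \<sigma> b" if "a \<noteq> b"
    using permutes_inverses[OF p] that by metis
  then show ?thesis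
    using *[of a b] *[of b a] slt_asym slt_irrefl assms(2,3) by (metis linorder_neqE_nat)
qed

lemma permutes_inv_bij: "\<sigma> permutes {1..n} \<Longrightarrow> bij_betw (inv \<sigma>) {1..n::nat} {1..n}"
  by (simp add: permutes_imp_bij permutes_inv)

lemma inv_eq_imp_permutes_eq:
  assumes "\<sigma> permutes A" "\<pi> permutes A" "\<And>a. a \<in> A \<Longrightarrow> inv \<sigma> a = inv \<pi> a"
  shows "\<sigma> = \<pi>"
proof -
  have "inv \<sigma> = inv \<pi>"
  proof
    fix a
    show "inv \<sigma> a = inv \<pi> a"
      using assms permutes_inv[of \<sigma> A] permutes_inv[of \<pi> A]
      by (cases "a \<in> A") (simp_all add: permutes_not_in)
  qed
  then show ?thesis
    using assms permutes_inv_inv by metis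
qed

text \<open>The inverse of a sorting permutation is the rank function of \<open>slt R S\<close> on
  \<open>{1..n}\<close>, and ranks are unique.\<close>

lemma sorts_unique:
  assumes "sorts R n S \<sigma>" "sorts R n S \<pi>"
  shows "\<sigma> = \<pi>"
proof (rule inv_eq_imp_permutes_eq)
  show p: "\<sigma> permutes {1..n}" "\<pi> permutes {1..n}" using assms by (auto simp: sorts_def)
  show "inv \<sigma> a = inv \<pi> a" if "a \<in> {1..n}" for a
    using rank_unique[OF permutes_inv_bij[OF p(1)] permutes_inv_bij[OF p(2)] _ that]
      sorts_slt_iff[OF assms(1)] sorts_slt_iff[OF assms(2)] by simp
qed

lemma ex_sorts: "\<exists>\<sigma>. sorts R n S \<sigma>"
proof -
  obtain r where r: "bij_betw r {1..n} {1..n}"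
    and iff: "\<And>a b. a \<in> {1..n} \<Longrightarrow> b \<in> {1..n} \<Longrightarrow> r a < r b \<longleftrightarrow> slt R S a b"
    using ex_rank[of "{1..n}" "slt R S"] slt_irrefl[of R S] slt_trans[of R S] slt_total[of _ _ R S]
    by auto
  \<comment> \<open>\<open>\<rho>\<close> sends an element to its rank; the sorted listing is its
    inverse.\<close>
  define \<rho> where "\<rho> a = (if a \<in> {1..n} then r a else a)" for a
  have p: "\<rho> permutes {1..n}"
  proof (rule bij_imp_permutes)
    show "bij_betw \<rho> {1..n} {1..n}"
      using r bij_betw_cong[of "{1..n}" \<rho> r "{1..n}"] by (simp add: \<rho>_def)
  qed (auto simp: \<rho>_def)
  have "slt R S (inv \<rho> j) (inv \<rho> (j + 1))" if "1 \<le> j" "j < n" for j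
  proof -
    have j: "inv \<rho> j \<in> {1..n}" "inv \<rho> (j + 1) \<in> {1..n}"
      using permutes_inv_in(1)[OF p] that by auto
    then have "r (inv \<rho> j) = j" "r (inv \<rho> (j + 1)) = j + 1"
      using permutes_inverses(1)[OF p, of j] permutes_inverses(1)[OF p, of "j + 1"]
      by (simp_all add: \<rho>_def)
    then show ?thesis using iff[OF j] by simp
  qed
  then have "sorts R n S (inv \<rho>)"
    using permutes_inv[OF p] by (simp add: sorts_def)
  then show ?thesis by blast
qed

text \<open>The tie clauses of \<open>Des\<close> say exactly that \<open>rlt R\<close> puts the
  later entry first.\<close>

lemma Des_eq_slt:
  assumes "\<sigma> permutes {1..n}"
  shows "Des R n S \<sigma> = {j. 1 \<le> j \<and> j < n \<and> slt R S (\<sigma> (j + 1)) (\<sigma> j)}"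
proof -
  have "\<sigma> j \<noteq> \<sigma> (j + 1)" for j
    using permutes_inj[OF assms] by (simp add: inj_eq)
  then show ?thesis
    unfolding Des_def slt_def rlt_def using sim_sym
    by (auto simp: eq_commute)
qed

text \<open>A descent \<open>i\<close> satisfies \<open>i < n\<close> and so contributes a positive
  \<open>n - i\<close>. This identifies \<open>tau R n\<close> as the permutation sorting the empty
  sequences.\<close>

lemma Comaj_eq_0_iff:
  assumes "\<sigma> permutes {1..n}"
  shows "Comaj R n S \<sigma> = 0 \<longleftrightarrow> sorts R n S \<sigma>"
proof -
  have ne: "\<sigma> j \<noteq> \<sigma> (j + 1)" for j
    using permutes_inj[OF assms] by (simp add: inj_eq)
  have fin: "finite (Des R n S \<sigma>)"
    by (rule finite_subset[of _ "{..<n}"]) (auto simp: Des_def)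
  have "Comaj R n S \<sigma> = 0 \<longleftrightarrow> Des R n S \<sigma> = {}"
    unfolding Comaj_def sum_eq_0_iff[OF fin] by (auto simp: Des_def)
  also have "\<dots> \<longleftrightarrow> sorts R n S \<sigma>"
    using Des_eq_slt[OF assms] ne slt_total slt_asym assms unfolding sorts_def by blast
  finally show ?thesis .
qed

lemma sorts_tau: "sorts R n (\<lambda>j. []) (tau R n)"
proof -
  obtain \<sigma> where s: "sorts R n (\<lambda>j. []) \<sigma>" using ex_sorts by blast
  have "tau R n = \<sigma>"
    unfolding tau_def
    by (rule the_equality) (use s Comaj_eq_0_iff sorts_unique in \<open>auto simp: sorts_def\<close>)
  with s show ?thesis by simp
qed

text \<open>Once \<open>\<pi>\<close> sorts \<open>S\<close>, every comparison by
  \<open>slt R S\<close> can be read off from positions in \<open>\<pi>\<close>.\<close>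

lemma Des_eq_inv_descents:
  assumes "sorts R n S \<pi>" "\<sigma> permutes {1..n}"
  shows "Des R n S \<sigma> = inv_descents n \<pi> \<sigma>"
proof -
  have "\<sigma> j \<in> {1..n}" "\<sigma> (j + 1) \<in> {1..n}" if "1 \<le> j" "j < n" for j
    using permutes_inv_in(2)[OF assms(2)] that by auto
  then show ?thesis
    unfolding Des_eq_slt[OF assms(2)] inv_descents_def using sorts_slt_iff[OF assms(1)] by blast
qed

text \<open>A tie in the new first coordinate is decided by the old order, which rejects it exactly
  at an inverse descent. Hence \<open>z\<close> read along \<open>\<sigma>\<close> increases weakly,
  and strictly at those places; \<open>of_bool\<close> merges the two inequalities.\<close>

lemma sorts_Cons_iff:
  assumes "sorts R n S \<pi>" "\<sigma> permutes {1..n}"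
  shows "sorts R n (\<lambda>a. z a # S a) \<sigma> \<longleftrightarrow>
    (\<forall>j. 1 \<le> j \<and> j < n \<longrightarrow> z (\<sigma> j) + of_bool (j \<in> inv_descents n \<pi> \<sigma>) \<le> z (\<sigma> (j + 1)))"
proof -
  have "slt R (\<lambda>a. z a # S a) (\<sigma> j) (\<sigma> (j + 1)) \<longleftrightarrow>
        z (\<sigma> j) + of_bool (j \<in> inv_descents n \<pi> \<sigma>) \<le> z (\<sigma> (j + 1))"
    if j: "1 \<le> j" "j < n" for j
  proof -
    have m: "\<sigma> j \<in> {1..n}" "\<sigma> (j + 1) \<in> {1..n}"
      using permutes_inv_in(2)[OF assms(2)] j by auto
    have "\<sigma> j \<noteq> \<sigma> (j + 1)"
      using permutes_inj[OF assms(2)] by (simp add: inj_eq)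
    moreover have "slt R S (\<sigma> (j + 1)) (\<sigma> j) \<longleftrightarrow> j \<in> inv_descents n \<pi> \<sigma>"
      using sorts_slt_iff[OF assms(1) m(2,1)] j by (simp add: inv_descents_def)
    ultimately have "slt R S (\<sigma> j) (\<sigma> (j + 1)) \<longleftrightarrow> j \<notin> inv_descents n \<pi> \<sigma>"
      using slt_total slt_asym by blast
    then show ?thesis unfolding slt_Cons by auto
  qed
  then show ?thesis using assms(2) by (auto simp: sorts_def)
qed

text \<open>After a step with \<open>\<sigma>\<close>, the order of the new sequences is the one listed by \<open>\<sigma>\<close>, whatever the
  old sequences were. Hence each descent set depends on two consecutive permutations only.\<close>

lemma sorts_Zstep:
  assumes "sorts R n S \<pi>" "\<sigma> permutes {1..n}"
  shows "sorts R n (Zstep R n \<sigma> S) \<sigma>"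
proof -
  have fin: "finite {k \<in> inv_descents n \<pi> \<sigma>. k < j}" for j by simp
  have "{k \<in> inv_descents n \<pi> \<sigma>. k < j + 1} =
        (if j \<in> inv_descents n \<pi> \<sigma> then insert j else id) {k \<in> inv_descents n \<pi> \<sigma>. k < j}" for j
    by (auto simp: less_Suc_eq)
  \<comment> \<open>The counts prepended by \<open>Zstep\<close> grow by one at each descent and
    nowhere else, the least growth that \<open>sorts_Cons_iff\<close> allows.\<close>
  then have "card {k \<in> inv_descents n \<pi> \<sigma>. k < j + 1} =
        card {k \<in> inv_descents n \<pi> \<sigma>. k < j} + of_bool (j \<in> inv_descents n \<pi> \<sigma>)" for j
    using fin by simp
  then show ?thesis
    unfolding Zstep_def sorts_Cons_iff[OF assms] Des_eq_inv_descents[OF assms]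
    by (simp add: permutes_inverses[OF assms(2)])
qed

lemma inv_descents_self: "\<pi> permutes {1..n} \<Longrightarrow> inv_descents n \<pi> \<pi> = {}"
  by (auto simp: inv_descents_def permutes_inverses)

lemma inv_comaj_eq_0_imp_eq:
  assumes "\<pi> permutes {1..n}" "\<sigma> permutes {1..n}" "inv_comaj n \<pi> \<sigma> = 0"
  shows "\<sigma> = \<pi>"
proof (rule sorts_unique)
  \<comment> \<open>These one-entry sequences have no ties on \<open>{1..n}\<close>, and sorting
    them means listing in the order of \<open>\<pi>\<close>; both permutations do so.\<close>
  let ?S = "\<lambda>a. [inv \<pi> a]"
  have fin: "finite (inv_descents n \<pi> \<sigma>)"
    by (rule finite_subset[of _ "{..<n}"]) (auto simp: inv_descents_def)
  have "inv_descents n \<pi> \<sigma> = {}"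
    using assms(3) unfolding inv_comaj_def sum_eq_0_iff[OF fin] by (auto simp: inv_descents_def)
  moreover have "inv \<pi> (\<sigma> j) \<noteq> inv \<pi> (\<sigma> (j + 1))" for j
    using assms(1,2) by (metis add_eq_self_zero one_neq_zero permutes_inverses(1,2))
  ultimately have "inv \<pi> (\<sigma> j) < inv \<pi> (\<sigma> (j + 1))" if "1 \<le> j" "j < n" for j
    using that unfolding inv_descents_def by (metis (mono_tags, lifting) empty_iff linorder_neqE_nat mem_Collect_eq)
  then show "sorts {} n ?S \<sigma>"
    using assms(2) by (auto simp: sorts_def slt_def)
  show "sorts {} n ?S \<pi>"
    using assms(1) by (auto simp: sorts_def slt_def permutes_inverses)
qed

lemma Comaj_eq_inv_comaj:
  assumes "sorts R n S \<pi>" "\<sigma> permutes {1..n}"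
  shows "Comaj R n S \<sigma> = inv_comaj n \<pi> \<sigma>"
  by (simp add: Comaj_def inv_comaj_def Des_eq_inv_descents[OF assms])

lemma tau_permutes: "tau R n permutes {1..n}"
  using sorts_tau by (simp add: sorts_def)

text \<open>Index shift: entry \<open>i\<close> is the exponent of \<open>q\<^sub>i\<^sub>+\<^sub>1\<close>.\<close>

lemma lookup_Qexp:
  assumes "sig \<in> seqs R n"
  shows "Poly_Mapping.lookup (Qexp R n sig) i = inv_comaj n (sig (i + 2)) (sig (i + 1))"
proof -
  define m where "m = mval R n sig"
  have perm: "sig k permutes {1..n}" if "1 \<le> k" for k
    using assms that by (simp add: seqs_def)
  obtain N where "\<forall>i>N. sig i = tau R n" using assms by (auto simp: seqs_def)
  then have "1 \<le> max 1 N \<and> (\<forall>i>max 1 N. sig i = tau R n)" by simp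
  then have m: "1 \<le> m" "\<And>i. m < i \<Longrightarrow> sig i = tau R n"
    unfolding m_def mval_def
    using LeastI[of "\<lambda>m. 1 \<le> m \<and> (\<forall>i>m. sig i = tau R n)"] by blast+
  define ps where "ps = map sig (rev [2..<m+1]) @ [id]"
  have "[1..<m+1] = 1 # [2..<m+1]"
    using m(1) by (subst upt_conv_Cons) (auto simp: numeral_2_eq_2)
  \<comment> \<open>The closing \<open>id\<close> appended by \<open>comaj_i\<close> is
    \<open>sig 1\<close>, so \<open>ps\<close> runs through \<open>sig\<close> from index
    \<open>m\<close> down to 1.\<close>
  then have "ps = map sig (rev [1..<m+1])"
    using assms by (simp add: ps_def seqs_def del: upt_Suc)
  then have ps: "ps ! k = sig (m - k)" if "k < m" for k
    using that by (simp add: rev_nth rev_map Suc_diff_Suc del: upt_Suc)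
  \<comment> \<open>Invariant: after \<open>k\<close> steps the sequences are ordered by
    \<open>sig (m + 1 - k)\<close>. It starts at \<open>sig (m + 1)\<close>, which is already
    \<open>tau R n\<close>.\<close>
  have Z: "k \<le> m \<Longrightarrow> sorts R n (Zseq R n ps k) (sig (m + 1 - k))" for k
  proof (induction k)
    case 0
    then show ?case using m(2) sorts_tau by simp
  next
    case (Suc k)
    then have "sorts R n (Zstep R n (sig (m - k)) (Zseq R n ps k)) (sig (m - k))"
      by (intro sorts_Zstep[of R n _ "sig (m + 1 - k)"] perm) auto
    then show ?case using Suc.prems ps by simp
  qed
  have comaj: "comaj_i R n (map sig (rev [2..<m+1])) (m - i) = inv_comaj n (sig (i + 2)) (sig (i + 1))"
    if "i < m"
  proof -
    have "comaj_i R n (map sig (rev [2..<m+1])) (m - i) = Comaj R n (Zseq R n ps (m - i - 1)) (sig (i + 1))"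
      unfolding comaj_i_def Let_def ps_def[symmetric] using that by (simp add: ps)
    also have "\<dots> = inv_comaj n (sig (i + 2)) (sig (i + 1))"
      using Z[of "m - i - 1"] that by (intro Comaj_eq_inv_comaj perm) (simp_all add: numeral_2_eq_2 Suc_diff_Suc)
    finally show ?thesis .
  qed
  \<comment> \<open>From index \<open>m\<close> on, both permutations compared are
    \<open>tau R n\<close>, in agreement with the default exponent 0.\<close>
  have zero: "inv_comaj n (sig (i + 2)) (sig (i + 1)) = 0" if "\<not> i < m"
    using that m(2) by (simp add: inv_comaj_def inv_descents_self[OF tau_permutes])
  have "Poly_Mapping.lookup (Qexp R n sig) i =
      (if i < m then comaj_i R n (map sig (rev [2..<m+1])) (m - i) else 0)"
    unfolding Qexp_def Let_def m_def[symmetric]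
    by (subst lookup_Abs_poly_mapping) auto
  then show ?thesis using comaj zero by simp
qed

section \<open>Words of monomials\<close>

text \<open>The number of these words is the coefficient of q^a in Gessel's fundamental
  quasisymmetric function of \<open>R\<close>, evaluated at all monomials. The value 0 outside
  \<open>{1..n}\<close> makes equality of functions the same as equality of words.\<close>

definition words :: "nat set \<Rightarrow> nat \<Rightarrow> mon \<Rightarrow> (nat \<Rightarrow> mon) set" where
  "words R n a = {w. (\<forall>k. k \<notin> {1..n} \<longrightarrow> w k = 0) \<and>
     (\<forall>j. 1 \<le> j \<and> j < n \<longrightarrow> w j \<le> w (j + 1) \<and> (j \<in> R \<longrightarrow> w j < w (j + 1))) \<and>
     (\<Sum>k=1..n. w k) = a}"

text \<open>The successive differences \<open>d\<close> of a partition with at most \<open>n\<close> parts (listed increasingly, starting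
  from 0) encode it; the difference at position \<open>l\<close> is shared by the last \<open>n - l\<close> parts.\<close>

definition gaps :: "nat \<Rightarrow> nat \<Rightarrow> (nat \<Rightarrow> nat) set" where
  "gaps n c = {d. (\<forall>l\<ge>n. d l = 0) \<and> (\<Sum>l<n. (n - l) * d l) = c}"

text \<open>A code splits the exponent of each variable into a comajor index and the size of a
  partition, matching the product of one tableau's part of the numerator with the inverse of the
  denominator.\<close>

definition codes :: "nat set \<Rightarrow> nat \<Rightarrow> mon \<Rightarrow> ((nat \<Rightarrow> nat \<Rightarrow> nat) \<times> (nat \<Rightarrow> nat \<Rightarrow> nat)) set" where
  "codes R n a = {(sig, d). sig \<in> seqs R n \<and> (\<forall>i. \<forall>l\<ge>n. d i l = 0) \<and>
     (\<forall>i. inv_comaj n (sig (i + 2)) (sig (i + 1)) + (\<Sum>l<n. (n - l) * d i l) = Poly_Mapping.lookup a i)}"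

text \<open>Lowering \<open>i\<close> by one prepends one exponent, as \<open>Zstep\<close> does, so
  \<open>sorts_Cons_iff\<close> relates consecutive tails.\<close>

definition tails :: "nat \<Rightarrow> nat \<Rightarrow> (nat \<Rightarrow> mon) \<Rightarrow> nat \<Rightarrow> nat list" where
  "tails M i w k = map (Poly_Mapping.lookup (w k)) [i..<M]"

definition incr :: "nat \<Rightarrow> (nat \<Rightarrow> nat \<Rightarrow> nat) \<Rightarrow> (nat \<Rightarrow> nat \<Rightarrow> nat) \<Rightarrow> nat \<Rightarrow> nat \<Rightarrow> nat" where
  "incr n sig d i l = d i l + of_bool (l \<in> inv_descents n (sig (i + 2)) (sig (i + 1)))"

text \<open>The row of \<open>i\<close>-th exponents, read in the order \<open>sig (i + 1)\<close>, is weakly increasing with a forced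
  strict increase at each descent; \<open>d i\<close> records the excess. Only the first \<open>M\<close> variables matter.\<close>

definition word_of :: "nat \<Rightarrow> nat \<Rightarrow> (nat \<Rightarrow> nat \<Rightarrow> nat) \<Rightarrow> (nat \<Rightarrow> nat \<Rightarrow> nat) \<Rightarrow> nat \<Rightarrow> mon" where
  "word_of M n sig d k = Abs_poly_mapping (\<lambda>i. if i < M \<and> k \<in> {1..n}
     then \<Sum>l<inv (sig (i + 1)) k. incr n sig d i l else 0)"

lemma lookup_word_of:
  "Poly_Mapping.lookup (word_of M n sig d k) i = (if i < M \<and> k \<in> {1..n}
     then \<Sum>l<inv (sig (i + 1)) k. incr n sig d i l else 0)"
  unfolding word_of_def by (subst lookup_Abs_poly_mapping) auto

lemma tails_Cons: "i < M \<Longrightarrow> tails M i w = (\<lambda>k. Poly_Mapping.lookup (w k) i # tails M (Suc i) w k)"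
  by (auto simp: tails_def upt_conv_Cons)

lemma tails_Nil: "M \<le> i \<Longrightarrow> tails M i w = (\<lambda>k. [])"
  by (auto simp: tails_def)

section \<open>Monomials compared through their exponent lists\<close>

lemma map_upt_less_iff:
  fixes f g :: "nat \<Rightarrow> nat"
  assumes "i \<le> M"
  shows "map f [i..<M] < map g [i..<M] \<longleftrightarrow>
    (\<exists>k. i \<le> k \<and> k < M \<and> f k < g k \<and> (\<forall>k'. i \<le> k' \<and> k' < k \<longrightarrow> f k' = g k'))"
  using assms
proof (induction i rule: inc_induct)
  case (step i)
  have "map f [i..<M] < map g [i..<M] \<longleftrightarrow> f i < g i \<or> f i = g i \<and> map f [Suc i..<M] < map g [Suc i..<M]"
    using step.hyps by (simp add: upt_conv_Cons)
  also have "\<dots> \<longleftrightarrow> (\<exists>k. i \<le> k \<and> k < M \<and> f k < g k \<and> (\<forall>k'. i \<le> k' \<and> k' < k \<longrightarrow> f k' = g k'))"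
    (is "_ \<longleftrightarrow> (\<exists>k. ?P k)")
  proof
    assume "f i < g i \<or> f i = g i \<and> map f [Suc i..<M] < map g [Suc i..<M]"
    then show "\<exists>k. ?P k"
    proof
      assume "f i < g i"
      then have "?P i" using step.hyps by auto
      then show ?thesis by blast
    next
      assume *: "f i = g i \<and> map f [Suc i..<M] < map g [Suc i..<M]"
      then obtain k where "Suc i \<le> k" "k < M" "f k < g k" "\<forall>k'. Suc i \<le> k' \<and> k' < k \<longrightarrow> f k' = g k'"
        using step.IH by blast
      then have "?P k" using * by (metis Suc_leD Suc_leI le_neq_implies_less)
      then show ?thesis by blast
    qed
  next
    assume "\<exists>k. ?P k"
    then obtain k where k: "?P k" by blast
    show "f i < g i \<or> f i = g i \<and> map f [Suc i..<M] < map g [Suc i..<M]"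
    proof (cases "k = i")
      case False
      then have "f i = g i" "Suc i \<le> k" using k by auto
      then show ?thesis using k step.IH by (metis Suc_leD)
    qed (use k in simp)
  qed
  finally show ?case .
qed auto

lemma lookup_eq_0_if_keys:
  fixes p :: mon
  assumes "Poly_Mapping.keys p \<subseteq> {..<M}" "M \<le> i"
  shows "Poly_Mapping.lookup p i = 0"
proof -
  have "i \<notin> Poly_Mapping.keys p" using assms by auto
  then show ?thesis by (simp add: in_keys_iff)
qed

text \<open>The library order looks at the first variable in which two monomials differ, which is
  lexicographic comparison of exponents. It thereby matches the order on sequences used by
  \<open>Des\<close>; the bound \<open>M\<close> keeps the lists finite.\<close>

lemma mon_less_iff:
  fixes p q :: mon
  assumes "Poly_Mapping.keys p \<subseteq> {..<M}" "Poly_Mapping.keys q \<subseteq> {..<M}"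
  shows "p < q \<longleftrightarrow> map (Poly_Mapping.lookup p) [0..<M] < map (Poly_Mapping.lookup q) [0..<M]"
proof -
  have "k < M" if "Poly_Mapping.lookup p k < Poly_Mapping.lookup q k" for k
    using lookup_eq_0_if_keys[OF assms(2), of k] that by fastforce
  then show ?thesis
    by (auto simp: map_upt_less_iff less_poly_mapping.rep_eq less_fun_def)
qed

lemma mon_eq_iff:
  fixes p q :: mon
  assumes "Poly_Mapping.keys p \<subseteq> {..<M}" "Poly_Mapping.keys q \<subseteq> {..<M}"
  shows "p = q \<longleftrightarrow> map (Poly_Mapping.lookup p) [0..<M] = map (Poly_Mapping.lookup q) [0..<M]"
proof
  assume *: "map (Poly_Mapping.lookup p) [0..<M] = map (Poly_Mapping.lookup q) [0..<M]"
  show "p = q"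
  proof (rule poly_mapping_eqI)
    fix k
    show "Poly_Mapping.lookup p k = Poly_Mapping.lookup q k"
      using * lookup_eq_0_if_keys[OF assms(1), of k] lookup_eq_0_if_keys[OF assms(2), of k]
      by (cases "k < M") auto
  qed
qed simp

text \<open>The neighbours \<open>j\<close> and \<open>j + 1\<close> are related by
  \<open>sim R\<close> exactly when \<open>j\<close> lies in \<open>R\<close>, so a tie between them
  is in order exactly when it does not.\<close>

lemma sorts_id_iff:
  assumes "\<And>k. Poly_Mapping.keys (w k) \<subseteq> {..<M}"
  shows "sorts R n (tails M 0 w) id \<longleftrightarrow>
    (\<forall>j. 1 \<le> j \<and> j < n \<longrightarrow> w j \<le> w (j + 1) \<and> (j \<in> R \<longrightarrow> w j < w (j + 1)))"
proof -
  have "rlt R j (j + 1) \<longleftrightarrow> j \<notin> R" for j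
    by (auto simp: rlt_def sim_def)
  then have "slt R (tails M 0 w) j (j + 1) \<longleftrightarrow> w j \<le> w (j + 1) \<and> (j \<in> R \<longrightarrow> w j < w (j + 1))" for j
    unfolding slt_def tails_def mon_less_iff[OF assms assms, symmetric] mon_eq_iff[OF assms assms, symmetric]
    by auto
  then show ?thesis
    by (simp add: sorts_def permutes_id)
qed

section \<open>The bijection between codes and words\<close>

lemma sum_partial_sums:
  fixes e :: "nat \<Rightarrow> nat"
  assumes "\<sigma> permutes {1..n}"
  shows "(\<Sum>k=1..n. \<Sum>l<inv \<sigma> k. e l) = (\<Sum>l<n. (n - l) * e l)"
proof -
  have "(\<Sum>k=1..n. \<Sum>l<inv \<sigma> k. e l) = (\<Sum>k=1..n. \<Sum>l<k. e l)"
    using sum.permute[OF permutes_inv[OF assms], of "\<lambda>k. \<Sum>l<k. e l"] by (simp add: comp_def)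
  \<comment> \<open>Counting by \<open>l\<close>: the increment \<open>e l\<close> enters the
    partial sums of the \<open>n - l\<close> values of \<open>k\<close> above
    \<open>l\<close>.\<close>
  also have "\<dots> = (\<Sum>l<n. (n - l) * e l)"
  proof (induction n)
    case (Suc n)
    have "(\<Sum>l<Suc n. (Suc n - l) * e l) = (\<Sum>l<Suc n. (n - l) * e l + e l)"
      by (intro sum.cong refl) (simp add: Suc_diff_le)
    then show ?case using Suc by (simp add: sum.distrib)
  qed simp
  finally show ?thesis .
qed

lemma sum_incr:
  "(\<Sum>l<n. (n - l) * incr n sig d i l) =
     inv_comaj n (sig (i + 2)) (sig (i + 1)) + (\<Sum>l<n. (n - l) * d i l)"
proof -
  let ?D = "inv_descents n (sig (i + 2)) (sig (i + 1))"
  have "(\<Sum>l<n. (n - l) * of_bool (l \<in> ?D)) = (\<Sum>l\<in>?D. n - l)"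
    by (rule sum.mono_neutral_cong_right) (auto simp: inv_descents_def)
  then show ?thesis
    by (simp add: incr_def inv_comaj_def add_mult_distrib2 sum.distrib)
qed

text \<open>Beyond the support of \<open>a\<close> two natural numbers add up to 0. A vanishing
  comajor index makes neighbouring permutations equal, hence equal to their eventual value, and the
  positive weights \<open>n - l\<close> make the gaps vanish.\<close>

lemma codes_stable:
  assumes "(sig, d) \<in> codes R n a" "Poly_Mapping.keys a \<subseteq> {..<M}" "M \<le> i"
  shows "sig (Suc i) = tau R n" "d i = (\<lambda>l. 0)"
proof -
  have sig: "sig \<in> seqs R n" using assms(1) by (simp add: codes_def)
  have zero: "inv_comaj n (sig (i + 2)) (sig (i + 1)) + (\<Sum>l<n. (n - l) * d i l) = 0" if "M \<le> i" for i
    using assms(1) lookup_eq_0_if_keys[OF assms(2) that] by (simp add: codes_def)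
  have step: "sig (Suc i) = sig (Suc (Suc i))" if "M \<le> i" for i
    using inv_comaj_eq_0_imp_eq[of "sig (i + 2)" n "sig (i + 1)"] zero[OF that] sig by (simp add: seqs_def)
  have const: "sig (Suc i) = sig (Suc (i + k))" for k
  proof (induction k)
    case (Suc k)
    then show ?case using step[of "i + k"] assms(3) by simp
  qed simp
  obtain N where "\<forall>j>N. sig j = tau R n" using sig by (auto simp: seqs_def)
  then show "sig (Suc i) = tau R n" using const[of N] by simp
  show "d i = (\<lambda>l. 0)"
  proof
    fix l
    have "(\<Sum>l<n. (n - l) * d i l) = 0" using zero[OF assms(3)] by simp
    then have "l < n \<Longrightarrow> d i l = 0" by simp
    moreover have "l \<ge> n \<Longrightarrow> d i l = 0" using assms(1) by (simp add: codes_def)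
    ultimately show "d i l = 0" by (cases "l < n") simp_all
  qed
qed

lemma keys_word_of: "Poly_Mapping.keys (word_of M n sig d k) \<subseteq> {..<M}"
  by (auto simp: in_keys_iff lookup_word_of split: if_splits)

lemma keys_words:
  assumes "w \<in> words R n a" "Poly_Mapping.keys a \<subseteq> {..<M}"
  shows "Poly_Mapping.keys (w k) \<subseteq> {..<M}"
proof (cases "k \<in> {1..n}")
  case True
  have "Poly_Mapping.lookup (w k) i \<le> Poly_Mapping.lookup a i" for i
  proof -
    have "Poly_Mapping.lookup a i = (\<Sum>k=1..n. Poly_Mapping.lookup (w k) i)"
      using assms(1) by (auto simp: words_def lookup_sum)
    then show ?thesis
      using True member_le_sum[of k "{1..n}" "\<lambda>k. Poly_Mapping.lookup (w k) i"] by simp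
  qed
  then show ?thesis
    using assms(2) by (metis in_keys_iff le_zero_eq subset_iff)
next
  case False
  then show ?thesis using assms(1) by (simp add: words_def)
qed

lemma lookup_word_of_perm:
  assumes "sig \<in> seqs R n" "i < M" "j \<in> {1..n}"
  shows "Poly_Mapping.lookup (word_of M n sig d (sig (i + 1) j)) i = (\<Sum>l<j. incr n sig d i l)"
proof -
  have p: "sig (i + 1) permutes {1..n}" using assms(1) by (simp add: seqs_def)
  show ?thesis
    using permutes_inv_in(2)[OF p assms(3)] assms(2) permutes_inverses(2)[OF p]
    by (simp add: lookup_word_of)
qed

text \<open>Downward induction from \<open>M\<close>, where the tails are empty and
  \<open>tau R n\<close> sorts them. Each step prepends a row whose increments are at least 1 at the
  descents, as \<open>sorts_Cons_iff\<close> requires.\<close>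

lemma sorts_word_of:
  assumes "(sig, d) \<in> codes R n a" "Poly_Mapping.keys a \<subseteq> {..<M}" "i \<le> M"
  shows "sorts R n (tails M i (word_of M n sig d)) (sig (Suc i))"
  using assms(3)
proof (induction i rule: inc_induct)
  case base
  show ?case
    using sorts_tau codes_stable(1)[OF assms(1,2)] by (simp add: tails_Nil)
next
  case (step i)
  have sig: "sig \<in> seqs R n" using assms(1) by (simp add: codes_def)
  then have p: "sig (Suc i) permutes {1..n}" by (simp add: seqs_def)
  show ?case
    unfolding tails_Cons[OF step.hyps(2)] sorts_Cons_iff[OF step.IH p]
    using lookup_word_of_perm[OF sig step.hyps(2)] by (auto simp: incr_def)
qed

text \<open>The case \<open>i = 0\<close> of \<open>sorts_word_of\<close>, with
  \<open>sig 1 = id\<close>, is the order condition on words; \<open>sum_partial_sums\<close> and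
  \<open>sum_incr\<close> give the product of the letters.\<close>

lemma word_of_in_words:
  assumes "(sig, d) \<in> codes R n a" "Poly_Mapping.keys a \<subseteq> {..<M}"
  shows "word_of M n sig d \<in> words R n a"
proof -
  have sig: "sig \<in> seqs R n" using assms(1) by (simp add: codes_def)
  have "sorts R n (tails M 0 (word_of M n sig d)) id"
    using sorts_word_of[OF assms, of 0] sig by (simp add: seqs_def)
  then have 1: "\<forall>j. 1 \<le> j \<and> j < n \<longrightarrow> word_of M n sig d j \<le> word_of M n sig d (j + 1) \<and>
      (j \<in> R \<longrightarrow> word_of M n sig d j < word_of M n sig d (j + 1))"
    using sorts_id_iff[of "word_of M n sig d" M R n, OF keys_word_of] by blast
  have 2: "word_of M n sig d k = 0" if "k \<notin> {1..n}" for k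
    using that by (intro poly_mapping_eqI) (auto simp: lookup_word_of)
  have 3: "(\<Sum>k=1..n. word_of M n sig d k) = a"
  proof (rule poly_mapping_eqI)
    fix i
    have p: "sig (i + 1) permutes {1..n}" using sig by (simp add: seqs_def)
    show "Poly_Mapping.lookup (\<Sum>k=1..n. word_of M n sig d k) i = Poly_Mapping.lookup a i"
    proof (cases "i < M")
      case True
      then have "Poly_Mapping.lookup (\<Sum>k=1..n. word_of M n sig d k) i =
          (\<Sum>k=1..n. \<Sum>l<inv (sig (i + 1)) k. incr n sig d i l)"
        unfolding lookup_sum by (intro sum.cong) (simp_all add: lookup_word_of)
      also have "\<dots> = Poly_Mapping.lookup a i"
        unfolding sum_partial_sums[OF p] sum_incr using assms(1) by (simp add: codes_def)
      finally show ?thesis .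
    next
      case False
      then show ?thesis
        using lookup_eq_0_if_keys[OF assms(2), of i] by (simp add: lookup_sum lookup_word_of)
    qed
  qed
  show ?thesis using 1 2 3 by (simp add: words_def)
qed

text \<open>The word determines its tails, each of which has only one sorting permutation. With
  \<open>sig\<close> known, differences of consecutive partial sums return \<open>d\<close>.\<close>

lemma word_of_inj:
  assumes c: "(sig, d) \<in> codes R n a" "(sig', d') \<in> codes R n a"
    and M: "Poly_Mapping.keys a \<subseteq> {..<M}"
    and eq: "word_of M n sig d = word_of M n sig' d'"
  shows "sig = sig'" "d = d'"
proof -
  have s: "sig \<in> seqs R n" "sig' \<in> seqs R n" using c by (auto simp: codes_def)
  show sig: "sig = sig'"
  proof
    fix k
    consider "k = 0" | i where "k = Suc i" "i < M" | i where "k = Suc i" "M \<le> i"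
      by (metis not0_implies_Suc not_le)
    then show "sig k = sig' k"
    proof cases
      case 1
      then show ?thesis using s by (simp add: seqs_def)
    next
      case 2
      then show ?thesis
        using sorts_word_of[OF c(1) M, of i] sorts_word_of[OF c(2) M, of i] eq sorts_unique
        by (metis less_imp_le)
    next
      case 3
      then show ?thesis using codes_stable(1)[OF c(1) M] codes_stable(1)[OF c(2) M] by metis
    qed
  qed
  show "d = d'"
  proof (intro ext)
    fix i l
    consider "M \<le> i" | "n \<le> l" | "i < M" "l < n" by linarith
    then show "d i l = d' i l"
    proof cases
      case 1
      then show ?thesis using codes_stable(2)[OF c(1) M] codes_stable(2)[OF c(2) M] by metis
    next
      case 2
      then show ?thesis using c by (simp add: codes_def)
    next
      case 3
      have *: "(\<Sum>l<j. incr n sig d i l) = (\<Sum>l<j. incr n sig' d' i l)" if "j \<le> n" for j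
      proof (cases "j = 0")
        case False
        then have "j \<in> {1..n}" using that by simp
        then show ?thesis
          using lookup_word_of_perm[OF s(1) 3(1), of j d] lookup_word_of_perm[OF s(2) 3(1), of j d'] eq sig
          by simp
      qed simp
      have "incr n sig d i l = incr n sig' d' i l"
        using *[of l] *[of "Suc l"] 3 by simp
      then show ?thesis using sig by (simp add: incr_def)
    qed
  qed
qed

lemma word_of_surj:
  assumes w: "w \<in> words R n a" and M: "Poly_Mapping.keys a \<subseteq> {..<M}"
  shows "\<exists>sig d. (sig, d) \<in> codes R n a \<and> word_of M n sig d = w"
proof -
  have kw: "\<And>k. Poly_Mapping.keys (w k) \<subseteq> {..<M}" using keys_words[OF w M] by simp
  \<comment> \<open>By \<open>sorts_word_of\<close> no other choice is possible: each permutation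
    must sort the corresponding tails of \<open>w\<close>.\<close>
  define sig where "sig i = (if i = 0 then id else SOME \<sigma>. sorts R n (tails M (i - 1) w) \<sigma>)" for i
  have sorts: "sorts R n (tails M i w) (sig (Suc i))" for i
    using someI_ex[OF ex_sorts[of R n "tails M i w"]] by (simp add: sig_def)
  have perm: "sig (Suc i) permutes {1..n}" for i
    using sorts by (simp add: sorts_def)
  have tau: "sig (Suc i) = tau R n" if "M \<le> i" for i
    using sorts[of i] sorts_tau sorts_unique by (simp add: tails_Nil[OF that])
  have "sorts R n (tails M 0 w) id"
    unfolding sorts_id_iff[OF kw] using w by (simp add: words_def)
  then have "sig (Suc 0) = id" using sorts[of 0] sorts_unique by blast
  moreover have "sig i permutes {1..n}" if "1 \<le> i" for i
    using perm[of "i - 1"] that by simp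
  moreover have "sig i = tau R n" if "M < i" for i
    using tau[of "i - 1"] that by simp
  ultimately have seqs: "sig \<in> seqs R n"
    unfolding seqs_def using sig_def[of 0] by simp blast
  \<comment> \<open>Row \<open>i\<close> read in sorted order; the artificial entry 0 at position 0
    makes the smallest exponent itself the first gap.\<close>
  define z where "z i j = (if j = 0 then 0 else Poly_Mapping.lookup (w (sig (Suc i) j)) i)" for i j
  \<comment> \<open>The truncated subtraction is exact for \<open>i < M\<close> by
    \<open>step\<close> below; for larger \<open>i\<close> the row vanishes and so does
    \<open>d i\<close>.\<close>
  define d where "d i l = (if l < n then z i (Suc l) - z i l -
      of_bool (l \<in> inv_descents n (sig (i + 2)) (sig (i + 1))) else 0)" for i l
  have z0: "z i j = 0" if "M \<le> i" for i j
    using lookup_eq_0_if_keys[OF kw that] by (simp add: z_def)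
  have step: "z i l + of_bool (l \<in> inv_descents n (sig (i + 2)) (sig (i + 1))) \<le> z i (Suc l)"
    if "l < n" "i < M" for i l
  proof (cases "l = 0")
    case True
    then show ?thesis by (simp add: z_def inv_descents_def)
  next
    case False
    then show ?thesis
      using sorts[of i] sorts_Cons_iff[OF sorts[of "Suc i"] perm[of i], of "\<lambda>k. Poly_Mapping.lookup (w k) i"] that
      by (simp add: z_def tails_Cons)
  qed
  have incr: "incr n sig d i l = z i (Suc l) - z i l" if "l < n" "i < M" for i l
    using step[OF that] that by (simp add: incr_def d_def)
  have zsum: "(\<Sum>l<j. incr n sig d i l) = z i j" if "j \<le> n" "i < M" for i j
    using that(1)
  proof (induction j)
    case 0
    then show ?case by (simp add: z_def)
  next
    case (Suc j)
    then show ?case using incr[of j i] step[of j i] that(2) by simp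
  qed
  have w_eq: "Poly_Mapping.lookup (w k) i = (\<Sum>l<inv (sig (i + 1)) k. incr n sig d i l)"
    if "i < M" "k \<in> {1..n}" for i k
    using permutes_inv_in(1)[OF perm[of i] that(2)] zsum[of "inv (sig (i + 1)) k" i]
      permutes_inverses(1)[OF perm[of i]] that(1)
    by (simp add: z_def)
  have word: "word_of M n sig d = w"
  proof (intro ext poly_mapping_eqI)
    fix k i
    show "Poly_Mapping.lookup (word_of M n sig d k) i = Poly_Mapping.lookup (w k) i"
      using w_eq[of i k] lookup_eq_0_if_keys[OF kw, of i k] w
      by (auto simp: lookup_word_of words_def)
  qed
  have "inv_comaj n (sig (i + 2)) (sig (i + 1)) + (\<Sum>l<n. (n - l) * d i l) = Poly_Mapping.lookup a i" for i
  proof (cases "i < M")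
    case True
    have "Poly_Mapping.lookup a i = (\<Sum>k=1..n. Poly_Mapping.lookup (w k) i)"
      using w by (auto simp: words_def lookup_sum)
    also have "\<dots> = (\<Sum>k=1..n. \<Sum>l<inv (sig (i + 1)) k. incr n sig d i l)"
      using w_eq[OF True] by simp
    also have "\<dots> = inv_comaj n (sig (i + 2)) (sig (i + 1)) + (\<Sum>l<n. (n - l) * d i l)"
      using sum_partial_sums[OF perm[of i]] sum_incr by simp
    finally show ?thesis ..
  next
    case False
    then have "inv_comaj n (sig (i + 2)) (sig (i + 1)) = 0"
      using tau[of i] tau[of "Suc i"] by (simp add: inv_comaj_def inv_descents_self[OF tau_permutes])
    moreover have "(\<Sum>l<n. (n - l) * d i l) = 0" using False by (simp add: d_def z0)
    ultimately show ?thesis using False lookup_eq_0_if_keys[OF M, of i] by simp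
  qed
  then have "(sig, d) \<in> codes R n a"
    using seqs by (simp add: codes_def d_def)
  with word show ?thesis by blast
qed

lemma keys_bounded: "\<exists>M. Poly_Mapping.keys (a :: mon) \<subseteq> {..<M}"
proof -
  have "Poly_Mapping.keys a \<subseteq> {..<Suc (Max (Poly_Mapping.keys a))}"
    by (auto simp: less_Suc_eq_le)
  then show ?thesis by blast
qed

lemma bij_betw_codes_words: "\<exists>f. bij_betw f (codes R n a) (words R n a)"
proof -
  obtain M where M: "Poly_Mapping.keys a \<subseteq> {..<M}" using keys_bounded by blast
  have "bij_betw (\<lambda>(sig, d). word_of M n sig d) (codes R n a) (words R n a)"
    unfolding bij_betw_def
  proof
    show "inj_on (\<lambda>(sig, d). word_of M n sig d) (codes R n a)"
      using word_of_inj[OF _ _ M] by (auto simp: inj_on_def)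
    show "(\<lambda>(sig, d). word_of M n sig d) ` codes R n a = words R n a"
      using word_of_in_words[OF _ M] word_of_surj[OF _ M] by (force simp: image_iff)
  qed
  then show ?thesis by blast
qed

section \<open>Power series\<close>

definition splits :: "mon \<Rightarrow> (mon \<times> mon) set" where
  "splits a = {(b, c). b + c = a}"

text \<open>A factorization of q^a amounts to an independent choice of the first factor's exponent
  in each variable of the support.\<close>

lemma bij_betw_splits_PiE:
  "bij_betw (\<lambda>(b, c). restrict (Poly_Mapping.lookup b) (Poly_Mapping.keys a)) (splits a)
     (PiE (Poly_Mapping.keys a) (\<lambda>i. {..Poly_Mapping.lookup a i}))"
proof (rule bij_betwI')
  let ?r = "\<lambda>(b :: mon, c :: mon). restrict (Poly_Mapping.lookup b) (Poly_Mapping.keys a)"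
  fix x y assume "x \<in> splits a" "y \<in> splits a"
  then obtain b c b' c' where xy: "x = (b, c)" "y = (b', c')" "b + c = a" "b' + c' = a"
    by (auto simp: splits_def)
  show "?r x = ?r y \<longleftrightarrow> x = y"
  proof
    assume *: "?r x = ?r y"
    have "Poly_Mapping.lookup b i = Poly_Mapping.lookup b' i" for i
    proof (cases "i \<in> Poly_Mapping.keys a")
      case True
      then show ?thesis using fun_cong[OF *, of i] xy by simp
    next
      case False
      then have "Poly_Mapping.lookup (b + c) i = 0" "Poly_Mapping.lookup (b' + c') i = 0"
        using xy by (simp_all add: in_keys_iff)
      then show ?thesis by (simp add: lookup_add)
    qed
    then have "b = b'" by (rule poly_mapping_eqI)
    then show "x = y" using xy by auto
  qed simp
next
  fix x assume "x \<in> splits a"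
  then show "(\<lambda>(b, c). restrict (Poly_Mapping.lookup b) (Poly_Mapping.keys a)) x
      \<in> PiE (Poly_Mapping.keys a) (\<lambda>i. {..Poly_Mapping.lookup a i})"
    by (auto simp: splits_def lookup_add)
next
  fix g assume g: "g \<in> PiE (Poly_Mapping.keys a) (\<lambda>i. {..Poly_Mapping.lookup a i})"
  define b where "b = Abs_poly_mapping (\<lambda>i. if i \<in> Poly_Mapping.keys a then g i else 0)"
  have b: "Poly_Mapping.lookup b i = (if i \<in> Poly_Mapping.keys a then g i else 0)" for i
    unfolding b_def by (subst lookup_Abs_poly_mapping) auto
  have "b + (a - b) = a"
    using g by (intro poly_mapping_eqI) (auto simp: lookup_add lookup_minus b in_keys_iff PiE_def Pi_def)
  moreover have "restrict (Poly_Mapping.lookup b) (Poly_Mapping.keys a) = g"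
    using g by (auto simp: b restrict_def PiE_def extensional_def)
  ultimately show "\<exists>x\<in>splits a. g = (\<lambda>(b, c). restrict (Poly_Mapping.lookup b) (Poly_Mapping.keys a)) x"
    by (auto simp: splits_def intro!: bexI[of _ "(b, a - b)"])
qed

lemma finite_splits: "finite (splits a)"
  using bij_betw_finite[OF bij_betw_splits_PiE] by (simp add: finite_PiE)

text \<open>Distributivity: a convolution whose terms factor over the variables can be carried out
  one variable at a time.\<close>

lemma sum_splits_prod:
  fixes f :: "nat \<Rightarrow> nat \<Rightarrow> 'a :: comm_ring_1"
  shows "(\<Sum>(b, c)\<in>splits a. \<Prod>i\<in>Poly_Mapping.keys a. f (Poly_Mapping.lookup b i) (Poly_Mapping.lookup c i)) =
    (\<Prod>i\<in>Poly_Mapping.keys a. \<Sum>x\<le>Poly_Mapping.lookup a i. f x (Poly_Mapping.lookup a i - x))"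
proof -
  have "(\<Prod>i\<in>Poly_Mapping.keys a. \<Sum>x\<le>Poly_Mapping.lookup a i. f x (Poly_Mapping.lookup a i - x)) =
    (\<Sum>g\<in>PiE (Poly_Mapping.keys a) (\<lambda>i. {..Poly_Mapping.lookup a i}).
       \<Prod>i\<in>Poly_Mapping.keys a. f (g i) (Poly_Mapping.lookup a i - g i))"
    by (rule prod_sum_PiE) auto
  also have "\<dots> = (\<Sum>(b, c)\<in>splits a. \<Prod>i\<in>Poly_Mapping.keys a.
      f (Poly_Mapping.lookup b i) (Poly_Mapping.lookup c i))"
    unfolding sum.reindex_bij_betw[OF bij_betw_splits_PiE, symmetric]
    by (intro sum.cong refl) (auto simp: splits_def lookup_add)
  finally show ?thesis ..
qed

lemma ser_mult_splits: "ser_mult f g a = (\<Sum>(b, c)\<in>splits a. f b * g c)"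
  by (simp add: ser_mult_def splits_def)

lemma ser_mult_commute: "ser_mult f g = ser_mult g f"
proof
  fix a
  show "ser_mult f g a = ser_mult g f a"
    unfolding ser_mult_splits
    by (rule sum.reindex_bij_witness[of _ prod.swap prod.swap]) (auto simp: splits_def add.commute)
qed

lemma ser_mult_assoc: "ser_mult (ser_mult f g) h = ser_mult f (ser_mult g h)"
proof
  fix a
  have "ser_mult (ser_mult f g) h a =
      (\<Sum>(x, y)\<in>Sigma (splits a) (\<lambda>x. splits (fst x)). f (fst y) * g (snd y) * h (snd x))"
    unfolding ser_mult_splits
    by (simp add: sum.Sigma finite_splits split_beta sum_distrib_right)
  \<comment> \<open>Both sums run over triples \<open>p\<close>, \<open>q\<close>, \<open>r\<close>
    with sum \<open>a\<close>; the witnesses only regroup them.\<close>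
  also have "\<dots> = (\<Sum>(x, y)\<in>Sigma (splits a) (\<lambda>x. splits (snd x)). f (fst x) * (g (fst y) * h (snd y)))"
    by (rule sum.reindex_bij_witness[of _
          "\<lambda>((p, x), (q, r)). ((p + q, r), (p, q))" "\<lambda>((x, r), (p, q)). ((p, q + r), (q, r))"])
      (auto simp: splits_def add.assoc mult.assoc)
  also have "\<dots> = ser_mult f (ser_mult g h) a"
    unfolding ser_mult_splits
    by (simp add: sum.Sigma finite_splits split_beta sum_distrib_left)
  finally show "ser_mult (ser_mult f g) h a = ser_mult f (ser_mult g h) a" .
qed

lemma ser_mult_one: "ser_mult f ser_one = f"
proof
  fix a
  have "ser_mult f ser_one a = (\<Sum>p\<in>{(a, 0)}. f (fst p) * ser_one (snd p))"
    unfolding ser_mult_splits split_beta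
    by (rule sum.mono_neutral_right) (use finite_splits in \<open>auto simp: splits_def ser_one_def\<close>)
  then show "ser_mult f ser_one a = f a" by (simp add: ser_one_def)
qed

text \<open>Inverses in a commutative monoid are unique, so the description in
  \<open>ser_inv\<close> denotes \<open>g\<close>.\<close>

lemma ser_inv_eqI:
  assumes "ser_mult f g = ser_one"
  shows "ser_inv f = g"
  unfolding ser_inv_def
proof (rule the_equality)
  fix h assume h: "ser_mult f h = ser_one"
  have "h = ser_mult h (ser_mult f g)" by (simp add: assms ser_mult_one)
  also have "\<dots> = ser_mult (ser_mult f h) g"
    by (metis ser_mult_assoc ser_mult_commute)
  also have "\<dots> = g" by (metis h ser_mult_commute ser_mult_one)
  finally show "h = g" .
qed (rule assms)

section \<open>Partitions with at most n parts and their generating function\<close>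

lemma finite_gaps: "finite (gaps n c)"
proof (rule finite_subset)
  show "finite {d. \<forall>l. (l \<in> {..<n} \<longrightarrow> d l \<in> {..c}) \<and> (l \<notin> {..<n} \<longrightarrow> d l = 0)}"
    by (rule finite_set_of_finite_funs) auto
  have "d l \<le> c" if "(\<Sum>l<n. (n - l) * d l) = c" "l < n" for d l
  proof -
    have "d l \<le> (n - l) * d l" using mult_le_mono1[of 1 "n - l" "d l"] that(2) by (simp add: Suc_le_eq)
    also have "\<dots> \<le> c"
      using member_le_sum[of l "{..<n}" "\<lambda>l. (n - l) * d l"] that by simp
    finally show ?thesis .
  qed
  then show "gaps n c \<subseteq> {d. \<forall>l. (l \<in> {..<n} \<longrightarrow> d l \<in> {..c}) \<and> (l \<notin> {..<n} \<longrightarrow> d l = 0)}"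
    by (auto simp: gaps_def)
qed

lemma gaps_0_right: "gaps n 0 = {\<lambda>l. 0}"
proof (intro equalityI subsetI)
  fix d assume d: "d \<in> gaps n 0"
  have "d l = 0" for l
    using d by (cases "l < n") (simp_all add: gaps_def)
  then show "d \<in> {\<lambda>l. 0}" by auto
qed (simp add: gaps_def)

lemma gaps_0_left: "gaps 0 c = (if c = 0 then {\<lambda>l. 0} else {})"
  by (auto simp: gaps_def)

lemma gaps_Suc_iff:
  "d \<in> gaps (Suc n) c \<longleftrightarrow> (\<lambda>l. d (Suc l)) \<in> gaps n (c - Suc n * d 0) \<and> Suc n * d 0 \<le> c"
proof -
  have "(\<forall>l\<ge>Suc n. d l = 0) \<longleftrightarrow> (\<forall>l\<ge>n. d (Suc l) = 0)"
    by (metis Suc_le_D Suc_le_mono)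
  then show ?thesis
    unfolding gaps_def by (auto simp: sum.lessThan_Suc_shift simp del: sum.lessThan_Suc)
qed

text \<open>If \<open>d 0\<close> is 0, dropping it leaves an element of \<open>gaps n c\<close>;
  otherwise lowering it by one removes its weight \<open>Suc n\<close> from the total.\<close>

lemma card_gaps_Suc:
  "card (gaps (Suc n) c) = card (gaps n c) + (if Suc n \<le> c then card (gaps (Suc n) (c - Suc n)) else 0)"
proof -
  let ?Z = "{d \<in> gaps (Suc n) c. d 0 = 0}" and ?P = "{d \<in> gaps (Suc n) c. 0 < d 0}"
  have "bij_betw (\<lambda>d l. d (Suc l)) ?Z (gaps n c)"
    by (rule bij_betw_byWitness[where f' = "case_nat 0"])
      (auto simp: gaps_Suc_iff fun_eq_iff split: nat.split)
  then have Z: "card ?Z = card (gaps n c)" by (rule bij_betw_same_card)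
  have P: "card ?P = (if Suc n \<le> c then card (gaps (Suc n) (c - Suc n)) else 0)"
  proof (cases "Suc n \<le> c")
    case True
    have "bij_betw (\<lambda>d. d(0 := d 0 - 1)) ?P (gaps (Suc n) (c - Suc n))"
    proof (rule bij_betw_byWitness[where f' = "\<lambda>d. d(0 := Suc (d 0))"])
      show "(\<lambda>d. d(0 := d 0 - 1)) ` ?P \<subseteq> gaps (Suc n) (c - Suc n)"
      proof clarify
        fix d assume d: "d \<in> gaps (Suc n) c" "0 < d 0"
        then obtain t where "d 0 = Suc t" using not0_implies_Suc by blast
        then show "d(0 := d 0 - 1) \<in> gaps (Suc n) (c - Suc n)"
          using d(1) by (auto simp: gaps_Suc_iff)
      qed
      show "(\<lambda>d. d(0 := Suc (d 0))) ` gaps (Suc n) (c - Suc n) \<subseteq> ?P"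
        using True by (auto simp: gaps_Suc_iff ac_simps)
    qed (auto simp: fun_eq_iff)
    then show ?thesis using True by (simp add: bij_betw_same_card)
  next
    case False
    have "Suc n \<le> c" if "d \<in> ?P" for d
    proof -
      have "Suc n * 1 \<le> Suc n * d 0" using that by (intro mult_le_mono2) simp
      also have "\<dots> \<le> c" using that unfolding gaps_Suc_iff by blast
      finally show ?thesis by simp
    qed
    then have "?P = {}" using False by blast
    then show ?thesis using False by (simp only: card.empty if_False)
  qed
  have "card (?Z \<union> ?P) = card ?Z + card ?P"
    by (rule card_Un_disjoint) (auto simp: finite_gaps)
  moreover have "?Z \<union> ?P = gaps (Suc n) c" by auto
  ultimately show ?thesis unfolding Z P by (simp only:)
qed

text \<open>The recursion \<open>card_gaps_Suc\<close> says that multiplying the series for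
  \<open>Suc n\<close> by 1 - q^(n+1) gives the series for \<open>n\<close>.\<close>

lemma qpoch_mult_gaps: "fps_of_poly (qpoch n) * Abs_fps (\<lambda>c. int (card (gaps n c))) = 1"
proof (induction n)
  case 0
  show ?case by (auto simp: qpoch_def fps_eq_iff gaps_0_left)
next
  case (Suc n)
  let ?F = "\<lambda>n. Abs_fps (\<lambda>c. int (card (gaps n c)))"
  have step: "?F (Suc n) * (1 - fps_X ^ Suc n) = ?F n"
    by (auto simp: fps_eq_iff algebra_simps fps_X_power_mult_nth card_gaps_Suc simp del: power_Suc)
  have "qpoch (Suc n) = qpoch n * (1 - monom 1 (Suc n))"
    by (simp add: qpoch_def)
  then have "fps_of_poly (qpoch (Suc n)) * ?F (Suc n) =
      fps_of_poly (qpoch n) * (?F (Suc n) * (1 - fps_X ^ Suc n))"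
    by (simp add: fps_of_poly_mult fps_of_poly_diff fps_of_poly_monom' mult_ac del: power_Suc)
  then show ?case unfolding step Suc.IH .
qed

text \<open>The product of all 1/(q_i; q_i)_n, written coefficientwise; a variable outside the
  support would contribute the constant term 1.\<close>

definition gap_series :: "nat \<Rightarrow> mser" where
  "gap_series n c = (\<Prod>i\<in>Poly_Mapping.keys c. int (card (gaps n (Poly_Mapping.lookup c i))))"

lemma coeff_qpoch_0: "coeff (qpoch n) 0 = 1"
  by (auto simp: poly_0_coeff_0[symmetric] qpoch_def poly_prod poly_monom intro!: prod.neutral)

lemma prod_keys_extend:
  fixes f :: "nat \<Rightarrow> int"
  assumes "f 0 = 1" "Poly_Mapping.keys b \<subseteq> Poly_Mapping.keys a"
  shows "(\<Prod>i\<in>Poly_Mapping.keys b. f (Poly_Mapping.lookup b i)) =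
    (\<Prod>i\<in>Poly_Mapping.keys a. f (Poly_Mapping.lookup b i))"
  by (rule prod.mono_neutral_left) (use assms in \<open>auto simp: in_keys_iff\<close>)

lemma ser_inv_qpoch_prod: "ser_inv (qpoch_prod n) = gap_series n"
proof (rule ser_inv_eqI, rule ext)
  fix a
  have conv: "(\<Sum>x\<le>m. coeff (qpoch n) x * int (card (gaps n (m - x)))) = (if m = 0 then 1 else 0)" for m
    using arg_cong[OF qpoch_mult_gaps, of "\<lambda>f. fps_nth f m"]
    by (simp add: fps_mult_nth atLeast0AtMost)
  have "ser_mult (qpoch_prod n) (gap_series n) a =
    (\<Sum>(b, c)\<in>splits a. \<Prod>i\<in>Poly_Mapping.keys a.
       coeff (qpoch n) (Poly_Mapping.lookup b i) * int (card (gaps n (Poly_Mapping.lookup c i))))"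
    unfolding ser_mult_splits
  proof (rule sum.cong[OF refl], clarify)
    fix b c assume "(b, c) \<in> splits a"
    then have "a = b + c" by (simp add: splits_def)
    then have "Poly_Mapping.keys b \<subseteq> Poly_Mapping.keys a" "Poly_Mapping.keys c \<subseteq> Poly_Mapping.keys a"
      by (auto simp: in_keys_iff lookup_add)
    then show "qpoch_prod n b * gap_series n c = (\<Prod>i\<in>Poly_Mapping.keys a.
       coeff (qpoch n) (Poly_Mapping.lookup b i) * int (card (gaps n (Poly_Mapping.lookup c i))))"
      using prod_keys_extend[of "coeff (qpoch n)" b a] prod_keys_extend[of "\<lambda>m. int (card (gaps n m))" c a]
      by (simp add: qpoch_prod_def gap_series_def prod.distrib coeff_qpoch_0 gaps_0_right)
  qed
  also have "\<dots> = (\<Prod>i\<in>Poly_Mapping.keys a. \<Sum>x\<le>Poly_Mapping.lookup a i.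
      coeff (qpoch n) x * int (card (gaps n (Poly_Mapping.lookup a i - x))))"
    by (rule sum_splits_prod)
  \<comment> \<open>Every factor is a coefficient of positive degree of the series 1. Only for
    \<open>a = 0\<close> is the product empty and equal to 1.\<close>
  also have "\<dots> = (\<Prod>i\<in>Poly_Mapping.keys a. 0)"
    unfolding conv by (rule prod.cong) (auto simp: in_keys_iff)
  also have "\<dots> = ser_one a"
    by (auto simp: ser_one_def prod_constant power_0_left)
  finally show "ser_mult (qpoch_prod n) (gap_series n) a = ser_one a" .
qed

section \<open>Counting words by codes\<close>

lemma card_gap_arrays:
  "int (card {d. \<forall>i. d i \<in> gaps n (Poly_Mapping.lookup c i)}) = gap_series n c"
proof -
  let ?K = "Poly_Mapping.keys c"
  \<comment> \<open>Off the support of \<open>c\<close> each row is forced to be 0, so restriction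
    loses nothing and leaves a finite product.\<close>
  have "bij_betw (\<lambda>d. restrict d ?K) {d. \<forall>i. d i \<in> gaps n (Poly_Mapping.lookup c i)}
      (PiE ?K (\<lambda>i. gaps n (Poly_Mapping.lookup c i)))"
  proof (rule bij_betw_byWitness[where f' = "\<lambda>g i. if i \<in> ?K then g i else (\<lambda>l. 0)"])
    have "d i = (\<lambda>l. 0)" if "d i \<in> gaps n (Poly_Mapping.lookup c i)" "i \<notin> ?K" for d i
      using that gaps_0_right by (simp add: in_keys_iff)
    then show "\<forall>d\<in>{d. \<forall>i. d i \<in> gaps n (Poly_Mapping.lookup c i)}.
        (\<lambda>i. if i \<in> ?K then restrict d ?K i else (\<lambda>l. 0)) = d"
      by (auto simp: fun_eq_iff)
    show "\<forall>g\<in>PiE ?K (\<lambda>i. gaps n (Poly_Mapping.lookup c i)).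
        restrict (\<lambda>i. if i \<in> ?K then g i else (\<lambda>l. 0)) ?K = g"
      by (auto simp: fun_eq_iff PiE_def extensional_def)
    show "(\<lambda>g i. if i \<in> ?K then g i else (\<lambda>l. 0)) ` PiE ?K (\<lambda>i. gaps n (Poly_Mapping.lookup c i))
        \<subseteq> {d. \<forall>i. d i \<in> gaps n (Poly_Mapping.lookup c i)}"
      by (auto simp: PiE_def Pi_def in_keys_iff gaps_0_right)
  qed auto
  then show ?thesis
    by (simp add: bij_betw_same_card card_PiE gap_series_def)
qed

lemma finite_words: "finite (words R n a)"
proof (rule finite_subset)
  let ?B = "fst ` splits a"
  show "finite {w. \<forall>k. (k \<in> {1..n} \<longrightarrow> w k \<in> ?B) \<and> (k \<notin> {1..n} \<longrightarrow> w k = 0)}"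
    by (rule finite_set_of_finite_funs) (simp_all add: finite_splits)
  have "w k \<in> ?B" if "w \<in> words R n a" "k \<in> {1..n}" for w k
  proof -
    have "a = w k + sum w ({1..n} - {k})"
      using that by (auto simp: words_def sum.remove)
    then have "(w k, sum w ({1..n} - {k})) \<in> splits a" by (simp add: splits_def)
    then show ?thesis by force
  qed
  then show "words R n a \<subseteq> {w. \<forall>k. (k \<in> {1..n} \<longrightarrow> w k \<in> ?B) \<and> (k \<notin> {1..n} \<longrightarrow> w k = 0)}"
    by (auto simp: words_def)
qed

text \<open>Codes are grouped by the monomial \<open>Qexp R n sig\<close>; its cofactor in q^a is
  what the gaps have to account for.\<close>

lemma codes_eq_UN:
  "codes R n a = (\<Union>p\<in>splits a. {sig \<in> seqs R n. Qexp R n sig = fst p} \<times>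
     {d. \<forall>i. d i \<in> gaps n (Poly_Mapping.lookup (snd p) i)})" (is "_ = ?U")
proof
  show "codes R n a \<subseteq> ?U"
  proof clarify
    fix sig d assume c: "(sig, d) \<in> codes R n a"
    then have sig: "sig \<in> seqs R n" by (simp add: codes_def)
    have eq: "Poly_Mapping.lookup a i = Poly_Mapping.lookup (Qexp R n sig) i + (\<Sum>l<n. (n - l) * d i l)" for i
      using c unfolding lookup_Qexp[OF sig] codes_def by simp
    have "Qexp R n sig + (a - Qexp R n sig) = a"
      by (intro poly_mapping_eqI) (simp add: lookup_add lookup_minus eq)
    then have "(Qexp R n sig, a - Qexp R n sig) \<in> splits a" by (simp add: splits_def)
    moreover have "d i \<in> gaps n (Poly_Mapping.lookup (a - Qexp R n sig) i)" for i
      using c by (simp add: gaps_def codes_def lookup_minus eq)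
    ultimately show "(sig, d) \<in> ?U" using sig by force
  qed
  show "?U \<subseteq> codes R n a"
    by (auto simp: splits_def codes_def gaps_def lookup_add lookup_Qexp)
qed

lemma card_words:
  "int (card (words R n a)) =
     ser_mult (\<lambda>b. int (card {sig \<in> seqs R n. Qexp R n sig = b})) (gap_series n) a"
proof -
  obtain f where f: "bij_betw f (codes R n a) (words R n a)" using bij_betw_codes_words by blast
  let ?A = "\<lambda>p. {sig \<in> seqs R n. Qexp R n sig = fst p} \<times>
     {d. \<forall>i. d i \<in> gaps n (Poly_Mapping.lookup (snd p) i)}"
  \<comment> \<open>Finiteness of the pieces \<open>?A p\<close>, needed to count their union, is
    imported from the words through the bijection.\<close>
  have fin: "finite (codes R n a)" using bij_betw_finite[OF f] finite_words by blast
  have "card (words R n a) = card (codes R n a)"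
    using bij_betw_same_card[OF f] by simp
  also have "\<dots> = (\<Sum>p\<in>splits a. card (?A p))"
    unfolding codes_eq_UN
  proof (rule card_UN_disjoint)
    show "\<forall>p\<in>splits a. finite (?A p)"
    proof
      fix p assume "p \<in> splits a"
      then have "?A p \<subseteq> codes R n a" unfolding codes_eq_UN by (rule UN_upper)
      then show "finite (?A p)" using fin by (rule finite_subset)
    qed
    show "\<forall>p\<in>splits a. \<forall>q\<in>splits a. p \<noteq> q \<longrightarrow> ?A p \<inter> ?A q = {}"
      by (auto simp: splits_def)
  qed (rule finite_splits)
  finally show ?thesis
    unfolding ser_mult_splits by (simp add: card_cartesian_product card_gap_arrays split_beta)
qed

section \<open>Standardization\<close>

lemma cells_Sigma: "cells lam = (SIGMA i:{..<length lam}. {..<lam ! i})"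
  by (auto simp: cells_def)

lemma finite_cells: "finite (cells lam)"
  by (simp add: cells_Sigma)

lemma card_cells: "card (cells lam) = sum_list lam"
  by (simp add: cells_Sigma card_SigmaI sum_list_sum_nth atLeast0LessThan)

lemma cells_closed:
  assumes "is_partition n lam" "(i', j') \<in> cells lam" "i \<le> i'" "j \<le> j'"
  shows "(i, j) \<in> cells lam"
  using assms sorted_rev_nth_mono[of lam i i'] by (auto simp: cells_def is_partition_def)

text \<open>Move along row \<open>i\<close> to the corner \<open>(i, j')\<close>, a cell because the
  shape is a partition, and then down its column; a nontrivial descent makes the inequality
  strict.\<close>

lemma ssyt_mono:
  fixes T :: "nat \<times> nat \<Rightarrow> 'a :: {linorder, zero}"
  assumes lam: "is_partition n lam" and T: "ssyt lam T"
    and c: "(i', j') \<in> cells lam" "i \<le> i'" "j \<le> j'"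
  shows "T (i, j) \<le> T (i', j')" "i < i' \<Longrightarrow> T (i, j) < T (i', j')"
proof -
  have row: "T (i, j) \<le> T (i, j + k)" if "(i, j + k) \<in> cells lam" for i k
    using that
  proof (induction k)
    case (Suc k)
    then have "(i, j + k) \<in> cells lam" by (simp add: cells_def)
    then have "T (i, j) \<le> T (i, j + k)" by (rule Suc.IH)
    also have "\<dots> \<le> T (i, j + k + 1)" using T Suc.prems unfolding ssyt_def by simp
    finally show ?case by simp
  qed simp
  have col: "T (i, j) < T (i + Suc k, j)" if "(i + Suc k, j) \<in> cells lam" for k j
    using that
  proof (induction k)
    case 0
    then show ?case using T unfolding ssyt_def by simp
  next
    case (Suc k)
    then have "(i + Suc k, j) \<in> cells lam"
      using cells_closed[OF lam] by (metis add_Suc_right le_add1 le_refl plus_1_eq_Suc add_le_cancel_left le_SucI)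
    then have "T (i, j) < T (i + Suc k, j)" by (rule Suc.IH)
    also have "\<dots> < T (i + Suc k + 1, j)" using T Suc.prems unfolding ssyt_def by simp
    finally show ?case by simp
  qed
  have "(i, j') \<in> cells lam" using cells_closed[OF lam c(1,2) order.refl] .
  then have r: "T (i, j) \<le> T (i, j')" using row[of i "j' - j"] c(3) by simp
  show lt: "T (i, j) < T (i', j')" if "i < i'"
  proof -
    obtain k where "i' = i + Suc k" using \<open>i < i'\<close> less_imp_Suc_add by fastforce
    then show ?thesis using r col[of k j'] c(1) by (metis order.strict_trans1)
  qed
  show "T (i, j) \<le> T (i', j')"
    using r lt c(2) by (cases "i = i'") (auto intro: less_imp_le)
qed

lemma syt_imp_ssyt: "syt lam T \<Longrightarrow> ssyt lam T"
  by (auto simp: syt_def ssyt_def intro: less_imp_le)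

lemma syt_outside: "syt lam T \<Longrightarrow> c \<notin> cells lam \<Longrightarrow> T c = 0"
  unfolding syt_def by blast

lemma ssyt_outside: "ssyt lam T \<Longrightarrow> c \<notin> cells lam \<Longrightarrow> T c = 0"
  unfolding ssyt_def by blast

lemma row_of_eq:
  assumes "syt lam T" "c \<in> cells lam"
  shows "row_of lam T (T c) = fst c"
proof -
  have "inj_on T (cells lam)" using assms(1) by (simp add: syt_def bij_betw_def)
  then have "(THE c'. c' \<in> cells lam \<and> T c' = T c) = c"
    using assms(2) by (intro the_equality) (auto dest: inj_onD)
  then show ?thesis by (simp add: row_of_def)
qed

text \<open>Equal entries of a semistandard tableau form a horizontal strip, so columns separate them.\<close>

definition cell_less :: "(nat \<times> nat \<Rightarrow> 'a :: linorder) \<Rightarrow> nat \<times> nat \<Rightarrow> nat \<times> nat \<Rightarrow> bool" where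
  "cell_less T c c' \<longleftrightarrow> T c < T c' \<or> T c = T c' \<and> snd c < snd c'"

lemma words_mono:
  assumes "w \<in> words R n a" "1 \<le> p" "p \<le> q" "q \<le> n"
  shows "w p \<le> w q"
  using assms(3,4)
proof (induction q rule: dec_induct)
  case (step q)
  then have "w p \<le> w q" by simp
  also have "w q \<le> w (q + 1)" using assms(1,2) step unfolding words_def by simp
  finally show ?case by simp
qed simp

text \<open>If \<open>w\<close> is constant from \<open>T c\<close> to \<open>T c'\<close>, no
  descent of \<open>T\<close> lies between, so the rows never move down. As \<open>c'\<close>
  carries the larger number without being lower, it must lie strictly to the right.\<close>

lemma syt_less_imp_cell_less:
  assumes lam: "is_partition n lam" and T: "syt lam T" and w: "w \<in> words (des lam T) n a"
    and c: "c \<in> cells lam" "c' \<in> cells lam" "T c < T c'"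
  shows "cell_less (w \<circ> T) c c'"
proof -
  have n: "sum_list lam = n" using lam by (simp add: is_partition_def)
  have range: "1 \<le> T c" "T c' \<le> n"
    using T c n by (auto simp: syt_def bij_betw_def)
  show ?thesis
  proof (cases "w (T c) < w (T c')")
    case True
    then show ?thesis by (simp add: cell_less_def)
  next
    case False
    then have eq: "w (T c) = w (T c')"
      using words_mono[OF w range(1) _ range(2)] c(3) by simp
    have "row_of lam T q \<le> row_of lam T (T c)" if "T c \<le> q" "q \<le> T c'" for q
      using that
    proof (induction q rule: dec_induct)
      case (step q)
      have "q \<notin> des lam T"
      proof
        assume "q \<in> des lam T"
        then have "w q < w (q + 1)" using w step range by (simp add: words_def)
        moreover have "w (T c) \<le> w q" "w (q + 1) \<le> w (T c')"
          using words_mono[OF w] step range by simp_all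
        ultimately show False using eq by simp
      qed
      then have "row_of lam T (q + 1) \<le> row_of lam T q"
        using step range n by (simp add: des_def)
      then show ?case using step by simp
    qed simp
    then have row: "fst c' \<le> fst c"
      using c row_of_eq[OF T] by (metis less_imp_le order.refl)
    have "snd c < snd c'"
    proof (rule ccontr)
      assume "\<not> snd c < snd c'"
      then have "T c' \<le> T c"
        using ssyt_mono(1)[OF lam syt_imp_ssyt[OF T], of "fst c" "snd c" "fst c'" "snd c'"] row c by simp
      then show False using c by simp
    qed
    then show ?thesis using eq by (simp add: cell_less_def)
  qed
qed

lemma syt_less_iff_cell_less:
  assumes lam: "is_partition n lam" and T: "syt lam T" and w: "w \<in> words (des lam T) n a"
    and c: "c \<in> cells lam" "c' \<in> cells lam"
  shows "T c < T c' \<longleftrightarrow> cell_less (w \<circ> T) c c'"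
proof -
  have "c = c'" if "T c = T c'"
    using T c that by (auto simp: syt_def bij_betw_def dest: inj_onD)
  moreover have "\<not> (cell_less (w \<circ> T) c c' \<and> cell_less (w \<circ> T) c' c)" "\<not> cell_less (w \<circ> T) c c"
    by (auto simp: cell_less_def)
  ultimately show ?thesis
    using syt_less_imp_cell_less[OF lam T w] c by (metis linorder_neqE_nat)
qed

lemma comp_syt_ssyt:
  assumes lam: "is_partition n lam" and T: "syt lam T" and w: "w \<in> words (des lam T) n a"
  shows "ssyt lam (w \<circ> T)" "(\<Sum>c\<in>cells lam. (w \<circ> T) c) = a"
proof -
  have n: "sum_list lam = n" using lam by (simp add: is_partition_def)
  have bij: "bij_betw T (cells lam) {1..n}" using T n by (simp add: syt_def)
  show "(\<Sum>c\<in>cells lam. (w \<circ> T) c) = a"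
    using sum.reindex_bij_betw[OF bij, of w] w by (simp add: words_def)
  have "(w \<circ> T) c = 0" if "c \<notin> cells lam" for c
    using syt_outside[OF T that] w by (simp add: words_def)
  moreover have "(w \<circ> T) (i, j) \<le> (w \<circ> T) (i, j + 1)" if "(i, j + 1) \<in> cells lam" for i j
  proof -
    have "(i, j) \<in> cells lam" using cells_closed[OF lam that] by simp
    moreover have "T (i, j) < T (i, j + 1)" using T that by (simp add: syt_def)
    ultimately have "cell_less (w \<circ> T) (i, j) (i, j + 1)"
      using syt_less_imp_cell_less[OF lam T w _ that] by blast
    then show ?thesis by (auto simp: cell_less_def)
  qed
  moreover have "(w \<circ> T) (i, j) < (w \<circ> T) (i + 1, j)" if "(i + 1, j) \<in> cells lam" for i j
  proof -
    have "(i, j) \<in> cells lam" using cells_closed[OF lam that] by simp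
    moreover have "T (i, j) < T (i + 1, j)" using T that by (simp add: syt_def)
    ultimately have "cell_less (w \<circ> T) (i, j) (i + 1, j)"
      using syt_less_imp_cell_less[OF lam T w _ that] by blast
    \<comment> \<open>Both cells share a column, so \<open>cell_less\<close> leaves only the strict
      inequality of entries.\<close>
    then show ?thesis by (auto simp: cell_less_def)
  qed
  ultimately show "ssyt lam (w \<circ> T)" unfolding ssyt_def by blast
qed

text \<open>The filling determines \<open>cell_less\<close>, of which \<open>T\<close> is the rank
  function; \<open>w\<close> is then known on the range of \<open>T\<close>.\<close>

lemma standardization_inj:
  assumes lam: "is_partition n lam"
    and T: "syt lam T" "w \<in> words (des lam T) n a"
    and T': "syt lam T'" "w' \<in> words (des lam T') n a"
    and eq: "w \<circ> T = w' \<circ> T'"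
  shows "T = T'" "w = w'"
proof -
  have n: "sum_list lam = n" using lam by (simp add: is_partition_def)
  have bij: "bij_betw T (cells lam) {1..n}" "bij_betw T' (cells lam) {1..n}"
    using T T' n by (auto simp: syt_def)
  show TT': "T = T'"
  proof
    fix c
    show "T c = T' c"
    proof (cases "c \<in> cells lam")
      case True
      show ?thesis
        by (rule rank_unique[OF bij _ True])
          (simp add: syt_less_iff_cell_less[OF lam T] syt_less_iff_cell_less[OF lam T'] eq)
    next
      case False
      then show ?thesis using syt_outside[OF T(1)] syt_outside[OF T'(1)] by simp
    qed
  qed
  show "w = w'"
  proof
    fix k
    show "w k = w' k"
    proof (cases "k \<in> {1..n}")
      case True
      then obtain c where "k = T c" using bij_betw_imp_surj_on[OF bij(1)] by blast
      then show ?thesis using fun_cong[OF eq, of c] TT' by simp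
    next
      case False
      then show ?thesis using T T' by (simp add: words_def)
    qed
  qed
qed

lemma standardization_surj:
  fixes T :: "nat \<times> nat \<Rightarrow> mon"
  assumes lam: "is_partition n lam" and T: "ssyt lam T" and sum: "(\<Sum>c\<in>cells lam. T c) = a"
  shows "\<exists>U w. syt lam U \<and> w \<in> words (des lam U) n a \<and> w \<circ> U = T"
proof -
  have n: "sum_list lam = n" using lam by (simp add: is_partition_def)
  \<comment> \<open>Two cells with equal entries in one column would violate strictness down
    columns.\<close>
  have total: "cell_less T c c' \<or> cell_less T c' c" if "c \<in> cells lam" "c' \<in> cells lam" "c \<noteq> c'" for c c'
  proof (cases "T c = T c' \<and> snd c = snd c'")
    case True
    then obtain i i' j where c: "c = (i, j)" "c' = (i', j)" by (cases c, cases c') auto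
    then have "i < i' \<or> i' < i" using that(3) by auto
    then have "T c \<noteq> T c'"
      using ssyt_mono(2)[OF lam T, of i j i' j] ssyt_mono(2)[OF lam T, of i' j i j] that c by force
    then show ?thesis using True by simp
  qed (auto simp: cell_less_def)
  have "\<exists>r. bij_betw r (cells lam) {1..card (cells lam)} \<and>
      (\<forall>c\<in>cells lam. \<forall>c'\<in>cells lam. r c < r c' \<longleftrightarrow> cell_less T c c')"
  proof (rule ex_rank[OF finite_cells])
    show "\<not> cell_less T c c" for c by (simp add: cell_less_def)
    show "cell_less T c c''" if "cell_less T c c'" "cell_less T c' c''" for c c' c''
      using that by (auto simp: cell_less_def)
  qed (rule total)
  then obtain r where r: "bij_betw r (cells lam) {1..n}"
    and iff: "\<And>c c'. c \<in> cells lam \<Longrightarrow> c' \<in> cells lam \<Longrightarrow> r c < r c' \<longleftrightarrow> cell_less T c c'"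
    unfolding card_cells n by blast
  define U where "U c = (if c \<in> cells lam then r c else 0)" for c
  have bij: "bij_betw U (cells lam) {1..n}"
    using r bij_betw_cong[of "cells lam" U r "{1..n}"] by (simp add: U_def)
  have iffU: "U c < U c' \<longleftrightarrow> cell_less T c c'" if "c \<in> cells lam" "c' \<in> cells lam" for c c'
    using iff that by (simp add: U_def)
  have "U (i, j) < U (i, j + 1)" if c: "(i, j + 1) \<in> cells lam" for i j
  proof -
    have "(i, j) \<in> cells lam" using cells_closed[OF lam c] by simp
    moreover have "T (i, j) \<le> T (i, j + 1)" using T c unfolding ssyt_def by blast
    ultimately show ?thesis using iffU c by (auto simp: cell_less_def)
  qed
  moreover have "U (i, j) < U (i + 1, j)" if c: "(i + 1, j) \<in> cells lam" for i j
  proof -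
    have "(i, j) \<in> cells lam" using cells_closed[OF lam c] by simp
    moreover have "T (i, j) < T (i + 1, j)" using T c unfolding ssyt_def by blast
    ultimately show ?thesis using iffU c by (auto simp: cell_less_def)
  qed
  ultimately have U: "syt lam U"
    unfolding syt_def n using bij by (simp add: U_def)
  define w where "w k = (if k \<in> {1..n} then T (inv_into (cells lam) U k) else 0)" for k
  have wU: "w (U c) = T c" for c
  proof (cases "c \<in> cells lam")
    case True
    then have "U c \<in> {1..n}" using bij by (auto simp: bij_betw_def)
    then show ?thesis using True bij by (simp add: w_def bij_betw_def)
  next
    case False
    then show ?thesis using ssyt_outside[OF T] by (simp add: w_def U_def)
  qed
  have "w k \<le> w (k + 1) \<and> (k \<in> des lam U \<longrightarrow> w k < w (k + 1))" if k: "1 \<le> k" "k < n" for k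
  proof -
    have "k \<in> U ` cells lam" "k + 1 \<in> U ` cells lam"
      using k bij by (auto simp: bij_betw_def)
    then obtain c c' where c: "c \<in> cells lam" "U c = k" and c': "c' \<in> cells lam" "U c' = k + 1"
      by (metis imageE)
    have less: "cell_less T c c'" using iffU[OF c(1) c'(1)] c c' by simp
    \<comment> \<open>At a descent with equal entries \<open>c'\<close> would be both lower and
      further right than \<open>c\<close>, where semistandardness forces a larger entry.\<close>
    have "T c < T c'" if "k \<in> des lam U"
    proof (rule ccontr)
      assume not: "\<not> T c < T c'"
      have "row_of lam U k < row_of lam U (k + 1)" using that by (simp add: des_def)
      then have "fst c < fst c'"
        using row_of_eq[OF U c(1)] row_of_eq[OF U c'(1)] c c' by simp
      moreover have "snd c < snd c'" using less not by (simp add: cell_less_def)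
      ultimately show False
        using ssyt_mono(2)[OF lam T, of "fst c'" "snd c'" "fst c" "snd c"] c' not by simp
    qed
    moreover have "T c \<le> T c'" using less by (auto simp: cell_less_def)
    moreover have "w k = T c" "w (k + 1) = T c'" using wU c c' by metis+
    ultimately show ?thesis by simp
  qed
  moreover have "(\<Sum>k=1..n. w k) = a"
    using sum.reindex_bij_betw[OF bij, of w] sum by (simp add: wU)
  ultimately have "w \<in> words (des lam U) n a"
    by (simp add: words_def w_def)
  moreover have "w \<circ> U = T" using wU by auto
  ultimately show ?thesis using U by blast
qed

lemma finite_syt: "finite {T. syt lam T}"
proof (rule finite_subset)
  show "finite {T. \<forall>c. (c \<in> cells lam \<longrightarrow> T c \<in> {1..sum_list lam}) \<and> (c \<notin> cells lam \<longrightarrow> T c = 0)}"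
    by (rule finite_set_of_finite_funs) (simp_all add: finite_cells)
  show "{T. syt lam T} \<subseteq>
      {T. \<forall>c. (c \<in> cells lam \<longrightarrow> T c \<in> {1..sum_list lam}) \<and> (c \<notin> cells lam \<longrightarrow> T c = 0)}"
    unfolding syt_def bij_betw_def by blast
qed

text \<open>Gessel's expansion of a Schur function into fundamental quasisymmetric functions, read
  coefficientwise.\<close>

lemma schur_eq_sum_card_words:
  assumes lam: "is_partition n lam"
  shows "schur_all_monomials lam a = (\<Sum>T\<in>{T. syt lam T}. int (card (words (des lam T) n a)))"
proof -
  have "bij_betw (\<lambda>(T, w). w \<circ> T) (SIGMA T:{T. syt lam T}. words (des lam T) n a)
      {T. ssyt lam T \<and> (\<Sum>c\<in>cells lam. T c) = a}"
    unfolding bij_betw_def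
  proof
    show "inj_on (\<lambda>(T, w). w \<circ> T) (SIGMA T:{T. syt lam T}. words (des lam T) n a)"
      by (rule inj_onI) (use standardization_inj[OF lam] in auto)
    show "(\<lambda>(T, w). w \<circ> T) ` (SIGMA T:{T. syt lam T}. words (des lam T) n a) =
        {T. ssyt lam T \<and> (\<Sum>c\<in>cells lam. T c) = a}"
      using comp_syt_ssyt[OF lam] standardization_surj[OF lam] by (fastforce simp: image_iff)
  qed
  then have "card {T :: nat \<times> nat \<Rightarrow> mon. ssyt lam T \<and> (\<Sum>c\<in>cells lam. T c) = a} =
      card (SIGMA T:{T. syt lam T}. words (des lam T) n a)"
    by (simp add: bij_betw_same_card)
  then show ?thesis
    by (simp add: schur_all_monomials_def card_SigmaI finite_syt finite_words)
qed

theorem theorem3: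
  fixes n :: nat and lam :: "nat list"
  assumes "1 \<le> n" and "is_partition n lam"
  shows "schur_all_monomials lam = ser_mult (numer lam) (ser_inv (qpoch_prod n))"
proof
  fix a
  have n: "sum_list lam = n" using assms(2) by (simp add: is_partition_def)
  have "schur_all_monomials lam a =
      (\<Sum>T\<in>{T. syt lam T}. \<Sum>(b, c)\<in>splits a.
         int (card {sig \<in> seqs (des lam T) n. Qexp (des lam T) n sig = b}) * gap_series n c)"
    by (simp only: schur_eq_sum_card_words[OF assms(2)] card_words ser_mult_splits)
  \<comment> \<open>The factor from \<open>gap_series n\<close> is common to all tableaux, so the
    tableau sum moves inside the convolution and becomes \<open>numer\<close>.\<close>
  also have "\<dots> = ser_mult (numer lam) (gap_series n) a"
    unfolding ser_mult_splits numer_def n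
    by (subst sum.swap) (simp add: sum_distrib_right split_beta)
  finally show "schur_all_monomials lam a = ser_mult (numer lam) (ser_inv (qpoch_prod n)) a"
    by (simp only: ser_inv_qpoch_prod)
qed

end
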